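(* Let $\mathbb K$ be $\mathbb R$ or $\mathbb C$. For the $\mathrm F^1_{\mathbb K}([0,1))$-valued measure $\phi=2\cdot\mathrm Z^1_{[0,1)}$ one has $\int|\phi|=2$, and the Magnus expansion $\sum_{k=1}^\infty\mu_{k,\mathrm R}(\phi)$ diverges in the Banach algebra $\mathrm F^1_{\mathbb K}([0,1))$.
   Context: $\mathrm F^1_{\mathbb K}([0,1))$ is the Banach algebra $L^1\big(\bigsqcup_{n\ge0}[0,1)^n;\mathbb K\big)$ (Lebesgue measure on each $[0,1)^n$, a one-point space of mass $1$ for $n=0$) with the $L^1$ norm and the product induced by $(fg)(t_1,\dots,t_{m+n})=f(t_1,\dots,t_m)\,g(t_{m+1},\dots,t_{m+n})$ for $f$ supported on $[0,1)^m$ and $g$ supported on $[0,1)^n$. $\mathrm Z^1_{[0,1)}$ is the measure on $[0,1)$ with values in $\mathrm F^1_{\mathbb K}([0,1))$ which sends a subinterval $J\subset[0,1)$ to the characteristic function of $J$ in the degree $1$ component $L^1([0,1))$. For a measure $\phi$ on an interval $I$, $\int|\phi|=\sup\sum_s|\phi(J_s)|$ over finite families of disjoint subintervals $J_s$ of $I$. For $\sigma\in\Sigma_k$, $\mathrm{asc}(\sigma)$ and $\mathrm{des}(\sigma)$ are the numbers of $i$ with $\sigma(i)<\sigma(i+1)$, resp. $\sigma(i)>\sigma(i+1)$; $\mu_k(X_1,\dots,X_k)=\sum_{\sigma\in\Sigma_k}(-1)^{\mathrm{des}(\sigma)}\frac{\mathrm{asc}(\sigma)!\,\mathrm{des}(\sigma)!}{k!}X_{\sigma(1)}\cdots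 X_{\sigma(k)}$ (the part of $\log(\exp(X_1)\cdots\exp(X_k))$ in which each variable has multiplicity exactly $1$), and $\mu_{k,\mathrm R}(\phi)=\int_{t_1\le\dots\le t_k\in I}\mu_k(\phi(t_1),\dots,\phi(t_k))$. *)

theory Defs
  imports "HOL-Probability.Probability"
begin

section \<open>The measure space \<open>\<Squnion>\<^sub>n [0,1)\<^sup>n\<close>\<close>

text \<open>
  A point of the disjoint union is encoded as a word, i.e. a list of numbers from \<open>[0,1)\<close> whose
  length is the index of the component it lies in. A set of words is measurable iff each of its
  components is measurable in the cube \<open>[0,1)\<^sup>n\<close>, and its measure is the sum of the volumes of
  the components; the component of length \<open>0\<close> is an atom of mass \<open>1\<close>.
\<close>

definition unit_interval :: "real measure" where
  "unit_interval = restrict_space lborel {0..<1}"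

definition cube :: "nat \<Rightarrow> (nat \<Rightarrow> real) measure" where
  "cube n = PiM {..<n} (\<lambda>_. unit_interval)"

definition word :: "nat \<Rightarrow> (nat \<Rightarrow> real) \<Rightarrow> real list" where
  "word n t = map t [0..<n]"

definition words :: "real list measure" where
  "words = measure_of (lists {0..<1})
     {A. A \<subseteq> lists {0..<1} \<and> (\<forall>n. word n -` A \<inter> space (cube n) \<in> sets (cube n))}
     (\<lambda>A. \<Sum>n. emeasure (cube n) (word n -` A \<inter> space (cube n)))"

lemma space_unit_interval [simp]: "space unit_interval = {0..<1}"
  by (simp add: unit_interval_def space_restrict_space)

lemma prob_space_unit_interval: "prob_space unit_interval"
  by (rule prob_spaceI) (simp add: unit_interval_def space_restrict_space emeasure_restrict_space)

interpretation unit_interval: product_sigma_finite "\<lambda>_::nat. unit_interval"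
  using prob_space_unit_interval
  by (simp add: product_sigma_finite_def prob_space_imp_sigma_finite)

lemma prob_space_cube: "prob_space (cube n)"
  unfolding cube_def by (intro prob_space_PiM prob_space_unit_interval)

lemma word_in_lists: "t \<in> space (cube n) \<Longrightarrow> word n t \<in> lists {0..<1}"
  by (auto simp: cube_def space_PiM word_def PiE_iff)

lemma sigma_algebra_words:
  "sigma_algebra (lists {0..<1})
     {A. A \<subseteq> lists {0..<1} \<and> (\<forall>n. word n -` A \<inter> space (cube n) \<in> sets (cube n))}"
proof (rule sigma_algebra_iff2[THEN iffD2], intro conjI ballI allI impI)
  fix A assume A: "A \<in> {A. A \<subseteq> lists {0..<1} \<and> (\<forall>n. word n -` A \<inter> space (cube n) \<in> sets (cube n))}"
  have "word n -` (lists {0..<1} - A) \<inter> space (cube n)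
      = space (cube n) - (word n -` A \<inter> space (cube n))" for n
    using word_in_lists by auto
  then show "lists {0..<1} - A
      \<in> {A. A \<subseteq> lists {0..<1} \<and> (\<forall>n. word n -` A \<inter> space (cube n) \<in> sets (cube n))}"
    using A by auto
next
  fix A :: "nat \<Rightarrow> real list set"
  assume A: "range A \<subseteq> {A. A \<subseteq> lists {0..<1} \<and> (\<forall>n. word n -` A \<inter> space (cube n) \<in> sets (cube n))}"
  have "(\<Union>i. word n -` A i \<inter> space (cube n)) \<in> sets (cube n)" for n
    using A by (intro sets.countable_UN) (auto simp: image_subset_iff)
  moreover have "word n -` (\<Union>i. A i) \<inter> space (cube n) = (\<Union>i. word n -` A i \<inter> space (cube n))" for n
    by auto
  moreover have "(\<Union>i. A i) \<subseteq> lists {0..<1}"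
    using A by (simp add: image_subset_iff UN_subset_iff del: in_lists_conv_set)
  ultimately show "(\<Union>i. A i) \<in> {A. A \<subseteq> lists {0..<1} \<and> (\<forall>n. word n -` A \<inter> space (cube n) \<in> sets (cube n))}"
    by (simp only: mem_Collect_eq) simp
qed auto

lemma space_words: "space words = lists {0..<1}"
  unfolding words_def by (rule space_measure_of_conv)

lemma sets_words:
  "sets words = {A. A \<subseteq> lists {0..<1} \<and> (\<forall>n. word n -` A \<inter> space (cube n) \<in> sets (cube n))}"
  unfolding words_def by (rule sigma_algebra.sets_measure_of_eq[OF sigma_algebra_words])

lemma measurable_word [measurable]: "word n \<in> cube n \<rightarrow>\<^sub>M words"
  by (auto simp: measurable_def space_words sets_words word_in_lists)

lemma measurable_words_iff:
  assumes "\<And>x. x \<in> lists {0..<1} \<Longrightarrow> f x \<in> space N"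
  shows "f \<in> words \<rightarrow>\<^sub>M N \<longleftrightarrow> (\<forall>n. (\<lambda>t. f (word n t)) \<in> cube n \<rightarrow>\<^sub>M N)"
proof
  assume "f \<in> words \<rightarrow>\<^sub>M N"
  then show "\<forall>n. (\<lambda>t. f (word n t)) \<in> cube n \<rightarrow>\<^sub>M N" by simp
next
  assume *: "\<forall>n. (\<lambda>t. f (word n t)) \<in> cube n \<rightarrow>\<^sub>M N"
  show "f \<in> words \<rightarrow>\<^sub>M N"
  proof (rule measurableI)
    fix A assume A: "A \<in> sets N"
    have "word n -` (f -` A \<inter> lists {0..<1}) \<inter> space (cube n)
        = (\<lambda>t. f (word n t)) -` A \<inter> space (cube n)" for n
      using word_in_lists by auto
    moreover have "(\<lambda>t. f (word n t)) -` A \<inter> space (cube n) \<in> sets (cube n)" for n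
      using * A by (blast intro: measurable_sets)
    ultimately show "f -` A \<inter> space words \<in> sets words"
      unfolding sets_words space_words by simp
  qed (use assms in \<open>simp add: space_words\<close>)
qed

lemma borel_measurable_words_iff:
  "f \<in> borel_measurable words \<longleftrightarrow> (\<forall>n. (\<lambda>t. f (word n t)) \<in> borel_measurable (cube n))"
  by (rule measurable_words_iff) auto

lemma suminf_ennreal_commute:
  fixes f :: "nat \<Rightarrow> nat \<Rightarrow> ennreal"
  shows "(\<Sum>i. \<Sum>j. f i j) = (\<Sum>j. \<Sum>i. f i j)"
proof -
  have "(\<Sum>i. \<Sum>j. f i j) = (\<integral>\<^sup>+ i. (\<Sum>j. f i j) \<partial>count_space UNIV)"
    by (simp add: nn_integral_count_space_nat)
  also have "\<dots> = (\<Sum>j. \<Sum>i. f i j)"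
    by (subst nn_integral_suminf) (simp_all add: nn_integral_count_space_nat)
  finally show ?thesis .
qed

lemma emeasure_words:
  assumes "A \<in> sets words"
  shows "emeasure words A = (\<Sum>n. emeasure (cube n) (word n -` A \<inter> space (cube n)))"
  unfolding words_def
proof (rule emeasure_measure_of_sigma[OF sigma_algebra_words])
  let ?S = "{A. A \<subseteq> lists {0..<1} \<and> (\<forall>n. word n -` A \<inter> space (cube n) \<in> sets (cube n))}"
  let ?\<mu> = "\<lambda>A. \<Sum>n. emeasure (cube n) (word n -` A \<inter> space (cube n))"
  show "positive ?S ?\<mu>" by (simp add: positive_def)
  show "countably_additive ?S ?\<mu>"
  proof (rule countably_additiveI)
    fix A :: "nat \<Rightarrow> real list set"
    assume A: "range A \<subseteq> ?S" "disjoint_family A"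
    have "(\<Sum>i. ?\<mu> (A i)) = (\<Sum>n. \<Sum>i. emeasure (cube n) (word n -` A i \<inter> space (cube n)))"
      by (rule suminf_ennreal_commute)
    also have "\<dots> = (\<Sum>n. emeasure (cube n) (\<Union>i. word n -` A i \<inter> space (cube n)))"
    proof (intro suminf_cong suminf_emeasure)
      show "range (\<lambda>i. word n -` A i \<inter> space (cube n)) \<subseteq> sets (cube n)" for n
        using A(1) by auto
      show "disjoint_family (\<lambda>i. word n -` A i \<inter> space (cube n))" for n
        using A(2) unfolding disjoint_family_on_def by blast
    qed
    also have "\<dots> = ?\<mu> (\<Union>i. A i)"
      by (simp add: vimage_UN)
    finally show "(\<Sum>i. ?\<mu> (A i)) = ?\<mu> (\<Union>i. A i)" .
  qed
qed (use assms in \<open>simp add: sets_words\<close>)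

lemma nn_integral_words:
  assumes "f \<in> borel_measurable words"
  shows "(\<integral>\<^sup>+ x. f x \<partial>words) = (\<Sum>n. \<integral>\<^sup>+ t. f (word n t) \<partial>cube n)"
  using assms
proof (induction rule: borel_measurable_induct)
  case (cong f g)
  then have "(\<integral>\<^sup>+ t. f (word n t) \<partial>cube n) = (\<integral>\<^sup>+ t. g (word n t) \<partial>cube n)" for n
    by (intro nn_integral_cong) (simp add: space_words word_in_lists)
  then show ?case using cong by (simp cong: nn_integral_cong)
next
  case (set A)
  have "(\<integral>\<^sup>+ t. indicator A (word n t) \<partial>cube n) = emeasure (cube n) (word n -` A \<inter> space (cube n))" for n
  proof -
    have "(\<integral>\<^sup>+ t. indicator A (word n t) \<partial>cube n)
        = (\<integral>\<^sup>+ t. indicator (word n -` A \<inter> space (cube n)) t \<partial>cube n)"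
      by (intro nn_integral_cong) (auto split: split_indicator)
    then show ?thesis using set by (simp add: measurable_sets[OF measurable_word])
  qed
  then show ?case using set by (simp add: emeasure_words)
next
  case (mult u c)
  then show ?case by (simp add: nn_integral_cmult)
next
  case (add u v)
  then show ?case by (simp add: nn_integral_add suminf_add)
next
  case (seq U)
  have m: "(\<lambda>t. U i (word n t)) \<in> borel_measurable (cube n)" for i n
    using seq by measurable
  have "(\<integral>\<^sup>+ x. (SUP i. U i) x \<partial>words) = (SUP i. \<integral>\<^sup>+ x. U i x \<partial>words)"
    using seq by (simp add: image_comp nn_integral_monotone_convergence_SUP)
  also have "\<dots> = (SUP i. \<Sum>n. \<integral>\<^sup>+ t. U i (word n t) \<partial>cube n)"
    using seq by simp
  also have "\<dots> = (\<Sum>n. SUP i. \<integral>\<^sup>+ t. U i (word n t) \<partial>cube n)"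
  proof (rule ennreal_suminf_SUP_eq[symmetric])
    show "incseq (\<lambda>i. \<integral>\<^sup>+ t. U i (word n t) \<partial>cube n)" for n
      using seq by (auto simp: incseq_def le_fun_def intro!: nn_integral_mono)
  qed
  also have "\<dots> = (\<Sum>n. \<integral>\<^sup>+ t. (SUP i. U i (word n t)) \<partial>cube n)"
    using seq m
    by (intro suminf_cong nn_integral_monotone_convergence_SUP[symmetric])
      (auto simp: incseq_def le_fun_def)
  finally show ?case by (simp add: image_comp)
qed

lemma measurable_subword:
  assumes "a + m \<le> n"
  shows "(\<lambda>t. map t [a..<a + m]) \<in> cube n \<rightarrow>\<^sub>M words"
proof -
  have "(\<lambda>t. \<lambda>k\<in>{..<m}. t (a + k)) \<in> cube n \<rightarrow>\<^sub>M cube m"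
    unfolding cube_def using assms by (intro measurable_restrict measurable_component_singleton) auto
  then have "(\<lambda>t. word m (\<lambda>k\<in>{..<m}. t (a + k))) \<in> cube n \<rightarrow>\<^sub>M words"
    by (rule measurable_compose[OF _ measurable_word])
  moreover have "word m (\<lambda>k\<in>{..<m}. t (a + k)) = map t [a..<a + m]" for t
    by (intro nth_equalityI) (auto simp: word_def)
  ultimately show ?thesis by simp
qed

lemma nn_integral_cube_split:
  assumes h [measurable]: "h \<in> borel_measurable (words \<Otimes>\<^sub>M words)"
  shows "(\<integral>\<^sup>+ t. h (map t [0..<i], map t [i..<i + j]) \<partial>cube (i + j))
       = (\<integral>\<^sup>+ x. \<integral>\<^sup>+ y. h (word i x, word j y) \<partial>cube j \<partial>cube i)"
proof -
  have m [measurable]: "(\<lambda>t. h (map t [0..<i], map t [i..<i + j])) \<in> borel_measurable (cube (i + j))"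
    using measurable_subword[of 0 i "i + j"] measurable_subword[of i j "i + j"]
    by (intro measurable_compose[OF measurable_Pair h]) auto
  have un: "{..<i + j} = {..<i} \<union> {i..<i + j}" by auto
  let ?s = "\<lambda>\<omega>::nat\<Rightarrow>real. \<lambda>n\<in>{i..<i + j}. \<omega> (n - i)"
  have re: "distr (cube j) (PiM {i..<i + j} (\<lambda>_. unit_interval)) ?s = PiM {i..<i + j} (\<lambda>_. unit_interval)"
    unfolding cube_def
    by (rule distr_PiM_reindex[where f = "\<lambda>n. n - i"])
      (auto intro: prob_space_unit_interval simp: inj_on_def)
  have ms: "?s \<in> cube j \<rightarrow>\<^sub>M PiM {i..<i + j} (\<lambda>_. unit_interval)"
    unfolding cube_def by (intro measurable_restrict measurable_component_singleton) auto
  have "(\<integral>\<^sup>+ t. h (map t [0..<i], map t [i..<i + j]) \<partial>cube (i + j))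
      = (\<integral>\<^sup>+ x. \<integral>\<^sup>+ y. (\<lambda>t. h (map t [0..<i], map t [i..<i + j])) (merge {..<i} {i..<i + j} (x, y))
           \<partial>PiM {i..<i + j} (\<lambda>_. unit_interval) \<partial>cube i)"
    using m unfolding cube_def un
    by (intro unit_interval.product_nn_integral_fold) auto
  also have "\<dots> = (\<integral>\<^sup>+ x. \<integral>\<^sup>+ y. (\<lambda>t. h (map t [0..<i], map t [i..<i + j])) (merge {..<i} {i..<i + j} (x, ?s y))
           \<partial>cube j \<partial>cube i)"
  proof (intro nn_integral_cong)
    fix x assume x: "x \<in> space (cube i)"
    have "(\<lambda>y. (\<lambda>t. h (map t [0..<i], map t [i..<i + j])) (merge {..<i} {i..<i + j} (x, y)))
        \<in> borel_measurable (PiM {i..<i + j} (\<lambda>_. unit_interval))"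
    proof (rule measurable_compose[OF _ m])
      show "(\<lambda>y. merge {..<i} {i..<i + j} (x, y)) \<in> PiM {i..<i + j} (\<lambda>_. unit_interval) \<rightarrow>\<^sub>M cube (i + j)"
        using x unfolding cube_def un
        by (intro measurable_compose[OF _ measurable_merge]) auto
    qed
    then show "(\<integral>\<^sup>+ y. (\<lambda>t. h (map t [0..<i], map t [i..<i + j])) (merge {..<i} {i..<i + j} (x, y))
           \<partial>PiM {i..<i + j} (\<lambda>_. unit_interval))
        = (\<integral>\<^sup>+ y. (\<lambda>t. h (map t [0..<i], map t [i..<i + j])) (merge {..<i} {i..<i + j} (x, ?s y)) \<partial>cube j)"
      by (subst re[symmetric], subst nn_integral_distr[OF ms]) simp_all
  qed
  also have "\<dots> = (\<integral>\<^sup>+ x. \<integral>\<^sup>+ y. h (word i x, word j y) \<partial>cube j \<partial>cube i)"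
  proof (intro nn_integral_cong arg_cong[where f = h])
    fix x y
    have "map (merge {..<i} {i..<i + j} (x, ?s y)) [0..<i] = word i x"
      by (auto simp: word_def merge_def)
    moreover have "map (merge {..<i} {i..<i + j} (x, ?s y)) [i..<i + j] = word j y"
      by (intro nth_equalityI) (auto simp: word_def merge_def)
    ultimately show "(map (merge {..<i} {i..<i + j} (x, ?s y)) [0..<i], map (merge {..<i} {i..<i + j} (x, ?s y)) [i..<i + j])
        = (word i x, word j y)" by simp
  qed
  finally show ?thesis .
qed

lemma sigma_finite_words: "sigma_finite_measure words"
proof
  let ?A = "\<lambda>n. {x \<in> lists {0..<1}. length x = n} :: real list set"
  have v: "word m -` ?A n \<inter> space (cube m) = (if m = n then space (cube m) else {})" for m n
    using word_in_lists by (auto simp: word_def)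
  have s: "?A n \<in> sets words" for n
    unfolding sets_words mem_Collect_eq v by auto
  have "emeasure words (?A n) \<noteq> \<infinity>" for n
  proof -
    have "emeasure words (?A n) = (\<Sum>m. if m = n then 1 else 0)"
      unfolding emeasure_words[OF s] v
      by (intro suminf_cong) (auto simp: prob_space.emeasure_space_1[OF prob_space_cube])
    also have "\<dots> = 1"
      by (subst suminf_finite[of "{n}"]) auto
    finally show ?thesis by simp
  qed
  then show "\<exists>A. countable A \<and> A \<subseteq> sets words \<and> \<Union> A = space words \<and> (\<forall>a\<in>A. emeasure words a \<noteq> \<infinity>)"
    using s by (intro exI[of _ "range ?A"]) (auto simp: space_words)
qed

interpretation words: sigma_finite_measure words by (rule sigma_finite_words)

lemma take_word: "i \<le> n \<Longrightarrow> take i (word n t) = map t [0..<i]"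
  by (simp add: word_def take_map)

lemma drop_word: "drop i (word n t) = map t [i..<n]"
  by (simp add: word_def drop_map)

lemma measurable_take_drop:
  assumes "i \<le> n"
  shows "(\<lambda>t. take i (word n t)) \<in> cube n \<rightarrow>\<^sub>M words" "(\<lambda>t. drop i (word n t)) \<in> cube n \<rightarrow>\<^sub>M words"
  using measurable_subword[of 0 i n] measurable_subword[of i "n - i" n] assms
  by (simp_all add: take_word drop_word)

lemma borel_measurable_splits:
  fixes h :: "real list \<times> real list \<Rightarrow> 'b :: {second_countable_topology, topological_comm_monoid_add}"
  assumes h: "h \<in> borel_measurable (words \<Otimes>\<^sub>M words)"
  shows "(\<lambda>x. \<Sum>i\<le>length x. h (take i x, drop i x)) \<in> borel_measurable words"
  unfolding borel_measurable_words_iff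
proof
  fix n
  have "(\<lambda>t. \<Sum>i\<le>n. h (take i (word n t), drop i (word n t))) \<in> borel_measurable (cube n)"
    by (intro borel_measurable_sum measurable_compose[OF measurable_Pair h] measurable_take_drop) auto
  then show "(\<lambda>t. \<Sum>i\<le>length (word n t). h (take i (word n t), drop i (word n t))) \<in> borel_measurable (cube n)"
    by (simp add: word_def)
qed

lemma suminf_ennreal_triangle:
  fixes f :: "nat \<Rightarrow> nat \<Rightarrow> ennreal"
  shows "(\<Sum>n. \<Sum>i\<le>n. f i (n - i)) = (\<Sum>i. \<Sum>j. f i j)"
proof -
  have "(\<Sum>n. \<Sum>i\<le>n. f i (n - i)) = (\<Sum>n. \<Sum>i. if i \<le> n then f i (n - i) else 0)"
    by (intro suminf_cong, subst suminf_finite[where N = "{..n}" for n]) auto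
  also have "\<dots> = (\<Sum>i. \<Sum>n. if i \<le> n then f i (n - i) else 0)"
    by (rule suminf_ennreal_commute)
  also have "\<dots> = (\<Sum>i. \<Sum>j. f i j)"
  proof (rule suminf_cong)
    fix i
    have "(\<Sum>n. if i \<le> n then f i (n - i) else 0)
        = (\<Sum>n. (if i \<le> n + i then f i (n + i - i) else 0)) + (\<Sum>n<i. if i \<le> n then f i (n - i) else 0)"
      by (rule suminf_offset) simp
    then show "(\<Sum>n. if i \<le> n then f i (n - i) else 0) = (\<Sum>j. f i j)" by simp
  qed
  finally show ?thesis .
qed

lemma nn_integral_splits:
  assumes h [measurable]: "h \<in> borel_measurable (words \<Otimes>\<^sub>M words)"
  shows "(\<integral>\<^sup>+ x. (\<Sum>i\<le>length x. h (take i x, drop i x)) \<partial>words) = (\<integral>\<^sup>+ x. \<integral>\<^sup>+ y. h (x, y) \<partial>words \<partial>words)"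
proof -
  have "(\<integral>\<^sup>+ x. (\<Sum>i\<le>length x. h (take i x, drop i x)) \<partial>words)
      = (\<Sum>n. \<integral>\<^sup>+ t. (\<Sum>i\<le>n. h (take i (word n t), drop i (word n t))) \<partial>cube n)"
    by (subst nn_integral_words[OF borel_measurable_splits[OF h]]) (simp add: word_def)
  also have "\<dots> = (\<Sum>n. \<Sum>i\<le>n. \<integral>\<^sup>+ t. h (take i (word n t), drop i (word n t)) \<partial>cube n)"
    by (intro suminf_cong nn_integral_sum measurable_compose[OF measurable_Pair h] measurable_take_drop) auto
  also have "\<dots> = (\<Sum>n. \<Sum>i\<le>n. \<integral>\<^sup>+ x. \<integral>\<^sup>+ y. h (word i x, word (n - i) y) \<partial>cube (n - i) \<partial>cube i)"
  proof (intro suminf_cong sum.cong refl)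
    fix n i :: nat assume "i \<in> {..n}"
    then show "(\<integral>\<^sup>+ t. h (take i (word n t), drop i (word n t)) \<partial>cube n)
       = (\<integral>\<^sup>+ x. \<integral>\<^sup>+ y. h (word i x, word (n - i) y) \<partial>cube (n - i) \<partial>cube i)"
      using nn_integral_cube_split[OF h, of i "n - i"] by (simp add: take_word drop_word)
  qed
  also have "\<dots> = (\<Sum>i. \<Sum>j. \<integral>\<^sup>+ x. \<integral>\<^sup>+ y. h (word i x, word j y) \<partial>cube j \<partial>cube i)"
    by (rule suminf_ennreal_triangle)
  also have "\<dots> = (\<Sum>i. \<integral>\<^sup>+ x. (\<Sum>j. \<integral>\<^sup>+ y. h (word i x, word j y) \<partial>cube j) \<partial>cube i)"
  proof (intro suminf_cong nn_integral_suminf[symmetric])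
    fix i j
    interpret prob_space "cube j" by (rule prob_space_cube)
    show "(\<lambda>x. \<integral>\<^sup>+ y. h (word i x, word j y) \<partial>cube j) \<in> borel_measurable (cube i)"
      by measurable
  qed
  also have "\<dots> = (\<Sum>i. \<integral>\<^sup>+ x. (\<integral>\<^sup>+ y. h (word i x, y) \<partial>words) \<partial>cube i)"
  proof (intro suminf_cong nn_integral_cong)
    fix i x assume x [measurable]: "x \<in> space (cube i)"
    then have [measurable]: "word i x \<in> space words" by (simp add: space_words word_in_lists)
    show "(\<Sum>j. \<integral>\<^sup>+ y. h (word i x, word j y) \<partial>cube j) = (\<integral>\<^sup>+ y. h (word i x, y) \<partial>words)"
      by (rule nn_integral_words[symmetric]) measurable
  qed
  also have "\<dots> = (\<integral>\<^sup>+ x. \<integral>\<^sup>+ y. h (x, y) \<partial>words \<partial>words)"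
    by (rule nn_integral_words[symmetric]) measurable
  finally show ?thesis .
qed


section \<open>The Banach algebra \<open>F\<^sup>1\<close>\<close>

definition ae_rel :: "(real list \<Rightarrow> 'k::{real_normed_field,banach,second_countable_topology}) \<Rightarrow> (real list \<Rightarrow> 'k) \<Rightarrow> bool" where
  "ae_rel f g \<longleftrightarrow> integrable words f \<and> integrable words g \<and> (AE x in words. f x = g x)"

text \<open>
  The type variable ranges over the scalar field. The intended instances are \<^typ>\<open>real\<close> and
  \<^typ>\<open>complex\<close>.
\<close>

quotient_type (overloaded) 'k F1 =
  "real list \<Rightarrow> 'k::{real_normed_field,banach,second_countable_topology}" / partial: ae_rel
proof (rule part_equivpI)
  show "\<exists>f::real list \<Rightarrow> 'k. ae_rel f f"
    by (rule exI[of _ "\<lambda>_. 0"]) (simp add: ae_rel_def)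
  show "symp (ae_rel :: (real list \<Rightarrow> 'k) \<Rightarrow> _)"
    by (auto intro!: sympI simp: ae_rel_def eq_commute)
  show "transp (ae_rel :: (real list \<Rightarrow> 'k) \<Rightarrow> _)"
  proof (rule transpI)
    fix f g h :: "real list \<Rightarrow> 'k"
    assume "ae_rel f g" "ae_rel g h"
    then show "ae_rel f h" by (auto simp: ae_rel_def elim: AE_mp)
  qed
qed

lemma ae_relD:
  assumes "ae_rel f g"
  shows "integrable words f" "integrable words g" "AE x in words. f x = g x"
  using assms by (auto simp: ae_rel_def)

instantiation F1 :: ("{real_normed_field,banach,second_countable_topology}") real_vector
begin

lift_definition zero_F1 :: "'a F1" is "\<lambda>_. 0"
  by (simp add: ae_rel_def)

lift_definition plus_F1 :: "'a F1 \<Rightarrow> 'a F1 \<Rightarrow> 'a F1" is "\<lambda>f g x. f x + g x"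
  by (auto simp: ae_rel_def elim: AE_mp)

lift_definition minus_F1 :: "'a F1 \<Rightarrow> 'a F1 \<Rightarrow> 'a F1" is "\<lambda>f g x. f x - g x"
  by (auto simp: ae_rel_def elim: AE_mp)

lift_definition uminus_F1 :: "'a F1 \<Rightarrow> 'a F1" is "\<lambda>f x. - f x"
  by (auto simp: ae_rel_def)

lift_definition scaleR_F1 :: "real \<Rightarrow> 'a F1 \<Rightarrow> 'a F1" is "\<lambda>c f x. c *\<^sub>R f x"
  by (auto simp: ae_rel_def)

instance
  by standard (transfer, auto simp: ae_rel_def algebra_simps scaleR_add_right scaleR_add_left)+

end

instantiation F1 :: ("{real_normed_field,banach,second_countable_topology}") real_normed_vector
begin

lift_definition norm_F1 :: "'a F1 \<Rightarrow> real" is "\<lambda>f. \<integral>x. norm (f x) \<partial>words"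
  by (intro integral_cong_AE) (auto simp: ae_rel_def)

definition dist_F1 :: "'a F1 \<Rightarrow> 'a F1 \<Rightarrow> real" where "dist_F1 f g = norm (f - g)"

definition sgn_F1 :: "'a F1 \<Rightarrow> 'a F1" where "sgn_F1 f = inverse (norm f) *\<^sub>R f"

definition uniformity_F1 :: "('a F1 \<times> 'a F1) filter" where
  "uniformity_F1 = (INF e\<in>{0<..}. principal {(x, y). dist x y < e})"

definition open_F1 :: "'a F1 set \<Rightarrow> bool" where
  "open_F1 U \<longleftrightarrow> (\<forall>x\<in>U. \<forall>\<^sub>F (x', y) in uniformity. x' = x \<longrightarrow> y \<in> U)"

instance
proof
  fix f g :: "'a F1" and c :: real
  show "dist f g = norm (f - g)" by (rule dist_F1_def)
  show "sgn f = inverse (norm f) *\<^sub>R f" by (rule sgn_F1_def)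
  show "norm f = 0 \<longleftrightarrow> f = 0"
    by transfer (auto simp: ae_rel_def integral_nonneg_eq_0_iff_AE)
  show "norm (f + g) \<le> norm f + norm g"
  proof transfer
    fix f g :: "real list \<Rightarrow> 'a"
    assume "ae_rel f f" "ae_rel g g"
    then have i: "integrable words f" "integrable words g" by (simp_all add: ae_rel_def)
    then have "(\<integral>x. norm (f x + g x) \<partial>words) \<le> (\<integral>x. norm (f x) + norm (g x) \<partial>words)"
      by (intro integral_mono) (auto simp: norm_triangle_ineq)
    also have "\<dots> = (\<integral>x. norm (f x) \<partial>words) + (\<integral>x. norm (g x) \<partial>words)"
      using i by (intro Bochner_Integration.integral_add) auto
    finally show "(\<integral>x. norm (f x + g x) \<partial>words) \<le> (\<integral>x. norm (f x) \<partial>words) + (\<integral>x. norm (g x) \<partial>words)" .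
  qed
  show "norm (c *\<^sub>R f) = \<bar>c\<bar> * norm f"
    by transfer simp
qed (rule uniformity_F1_def open_F1_def)+

end

text \<open>
  The product comes from concatenation: the value at a word collects the contributions of all
  ways of cutting it into a prefix and a suffix. For \<open>f\<close> supported on words of length \<open>m\<close> and
  \<open>g\<close> supported on words of length \<open>n\<close>, only the cut after the first \<open>m\<close> letters of a word of
  length \<open>m + n\<close> contributes.
\<close>

definition concat_prod :: "(real list \<Rightarrow> 'k::real_normed_field) \<Rightarrow> (real list \<Rightarrow> 'k) \<Rightarrow> real list \<Rightarrow> 'k" where
  "concat_prod f g x = (\<Sum>i\<le>length x. f (take i x) * g (drop i x))"

lemma concat_prod_assoc: "concat_prod (concat_prod f g) h = concat_prod f (concat_prod g h)"
proof
  fix x :: "real list"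
  let ?F = "\<lambda>i j k. f (take i x) * g (take j (drop i x)) * h (drop (i + j) x)"
  have "concat_prod (concat_prod f g) h x
      = (\<Sum>n = 0..length x. \<Sum>i = 0..n. ?F i (n - i) (length x - n))"
    unfolding concat_prod_def sum_distrib_right atMost_atLeast0
    by (intro sum.cong) (auto simp: drop_take min_absorb1 min_absorb2)
  also have "\<dots> = (\<Sum>n = 0..length x. \<Sum>i = 0..length x - n. ?F n i (length x - n - i))"
    by (rule fps_mult_assoc_lemma)
  also have "\<dots> = concat_prod f (concat_prod g h) x"
    unfolding concat_prod_def sum_distrib_left atMost_atLeast0
    by (intro sum.cong) (auto simp: mult.assoc add.commute)
  finally show "concat_prod (concat_prod f g) h x = concat_prod f (concat_prod g h) x" .
qed

lemma concat_prod_linear: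
  "concat_prod (\<lambda>x. f x + g x) h = (\<lambda>x. concat_prod f h x + concat_prod g h x)"
  "concat_prod f (\<lambda>x. g x + h x) = (\<lambda>x. concat_prod f g x + concat_prod f h x)"
  "concat_prod (\<lambda>x. c *\<^sub>R f x) g = (\<lambda>x. c *\<^sub>R concat_prod f g x)"
  "concat_prod f (\<lambda>x. c *\<^sub>R g x) = (\<lambda>x. c *\<^sub>R concat_prod f g x)"
  by (simp_all add: concat_prod_def fun_eq_iff sum.distrib distrib_left distrib_right scaleR_sum_right)

lemma
  fixes f g :: "real list \<Rightarrow> 'k::{real_normed_field,banach,second_countable_topology}"
  assumes f: "integrable words f" and g: "integrable words g"
  shows integrable_concat_prod: "integrable words (concat_prod f g)"
    and integral_norm_concat_prod:
      "(\<integral>x. norm (concat_prod f g x) \<partial>words) \<le> (\<integral>x. norm (f x) \<partial>words) * (\<integral>x. norm (g x) \<partial>words)"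
proof -
  have [measurable]: "f \<in> borel_measurable words" "g \<in> borel_measurable words"
    using f g by auto
  have m [measurable]: "concat_prod f g \<in> borel_measurable words"
    using borel_measurable_splits[of "\<lambda>(x, y). f x * g y"] by (simp add: concat_prod_def[abs_def])
  have "(\<integral>\<^sup>+ x. norm (concat_prod f g x) \<partial>words)
      \<le> (\<integral>\<^sup>+ x. (\<Sum>i\<le>length x. case (take i x, drop i x) of (x, y) \<Rightarrow> ennreal (norm (f x)) * ennreal (norm (g y))) \<partial>words)"
  proof (rule nn_integral_mono)
    fix x
    have "ennreal (norm (concat_prod f g x)) \<le> ennreal (\<Sum>i\<le>length x. norm (f (take i x)) * norm (g (drop i x)))"
      unfolding concat_prod_def
      by (intro ennreal_leI order_trans[OF norm_sum] sum_mono norm_mult_ineq)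
    also have "\<dots> = (\<Sum>i\<le>length x. case (take i x, drop i x) of (x, y) \<Rightarrow> ennreal (norm (f x)) * ennreal (norm (g y)))"
      by (simp add: ennreal_mult sum_nonneg flip: sum_ennreal)
    finally show "ennreal (norm (concat_prod f g x))
        \<le> (\<Sum>i\<le>length x. case (take i x, drop i x) of (x, y) \<Rightarrow> ennreal (norm (f x)) * ennreal (norm (g y)))" .
  qed
  also have "\<dots> = (\<integral>\<^sup>+ x. \<integral>\<^sup>+ y. ennreal (norm (f x)) * ennreal (norm (g y)) \<partial>words \<partial>words)"
    by (subst nn_integral_splits) simp_all
  also have "\<dots> = (\<integral>\<^sup>+ x. norm (f x) \<partial>words) * (\<integral>\<^sup>+ x. norm (g x) \<partial>words)"
    by (simp add: nn_integral_cmult nn_integral_multc)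
  also have "\<dots> = ennreal ((\<integral>x. norm (f x) \<partial>words) * (\<integral>x. norm (g x) \<partial>words))"
    using f g by (simp add: nn_integral_eq_integral ennreal_mult)
  finally have le: "(\<integral>\<^sup>+ x. norm (concat_prod f g x) \<partial>words)
      \<le> ennreal ((\<integral>x. norm (f x) \<partial>words) * (\<integral>x. norm (g x) \<partial>words))" .
  show i: "integrable words (concat_prod f g)"
    using le by (intro integrableI_bounded m) (auto intro: le_less_trans)
  show "(\<integral>x. norm (concat_prod f g x) \<partial>words) \<le> (\<integral>x. norm (f x) \<partial>words) * (\<integral>x. norm (g x) \<partial>words)"
    using le i by (simp add: nn_integral_eq_integral ennreal_le_iff)
qed

lemma AE_splits:
  fixes f f' g g' :: "real list \<Rightarrow> 'k::{real_normed_field,banach,second_countable_topology}"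
  assumes "ae_rel f f'" "ae_rel g g'"
  shows "AE x in words. concat_prod f g x = concat_prod f' g' x"
proof -
  have [measurable]: "f \<in> borel_measurable words" "g \<in> borel_measurable words"
    "f' \<in> borel_measurable words" "g' \<in> borel_measurable words"
    using assms by (auto simp: ae_rel_def)
  let ?h = "\<lambda>(x, y). of_bool (f x \<noteq> f' x \<or> g y \<noteq> g' y) :: ennreal"
  have h: "?h \<in> borel_measurable (words \<Otimes>\<^sub>M words)"
    by measurable
  have "(\<integral>\<^sup>+ x. \<integral>\<^sup>+ y. ?h (x, y) \<partial>words \<partial>words) = (\<integral>\<^sup>+ x. 0 \<partial>words)"
  proof (rule nn_integral_cong_AE)
    show "AE x in words. (\<integral>\<^sup>+ y. ?h (x, y) \<partial>words) = 0"
      using ae_relD(3)[OF assms(1)]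
    proof eventually_elim
      case (elim x)
      have "(\<integral>\<^sup>+ y. ?h (x, y) \<partial>words) = (\<integral>\<^sup>+ y. 0 \<partial>words)"
        using ae_relD(3)[OF assms(2)] elim by (intro nn_integral_cong_AE) auto
      then show ?case by simp
    qed
  qed
  then have "(\<integral>\<^sup>+ x. (\<Sum>i\<le>length x. ?h (take i x, drop i x)) \<partial>words) = 0"
    by (subst nn_integral_splits[OF h]) simp
  then have "AE x in words. (\<Sum>i\<le>length x. ?h (take i x, drop i x)) = 0"
    by (subst (asm) nn_integral_0_iff_AE[OF borel_measurable_splits[OF h]])
  then show ?thesis
    by eventually_elim (auto simp: concat_prod_def intro!: sum.cong)
qed

lemma
  assumes "A \<in> sets words" "emeasure words A < \<infinity>"
  shows integrable_indicator_words:
      "integrable words (indicator A :: real list \<Rightarrow> 'k::{real_normed_field,banach,second_countable_topology})"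
    and integral_norm_indicator_words:
      "(\<integral>x. norm (indicator A x :: 'k) \<partial>words) = measure words A"
proof -
  have "integrable words (\<lambda>x. indicator A x *\<^sub>R (1 :: 'k))"
    using assms by (intro integrable_scaleR_left integrable_real_indicator)
  then show "integrable words (indicator A :: real list \<Rightarrow> 'k)"
    by (rule Bochner_Integration.integrable_cong[THEN iffD1, rotated 2]) (auto split: split_indicator)
  have "(\<integral>x. norm (indicator A x :: 'k) \<partial>words) = (\<integral>x. indicator A x \<partial>words)"
    by (intro Bochner_Integration.integral_cong) (auto split: split_indicator)
  also have "\<dots> = measure words A"
    using sets.sets_into_space[OF assms(1)] by (simp add: Int_absorb2)
  finally show "(\<integral>x. norm (indicator A x :: 'k) \<partial>words) = measure words A" .
qed

lemma sets_words_Nil: "{[]} \<in> sets words"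
  and emeasure_words_Nil: "emeasure words {[]} = 1"
proof -
  have v: "word n -` {[]} \<inter> space (cube n) = (if n = 0 then space (cube n) else {})" for n
    by (auto simp: word_def)
  show s: "{[]} \<in> sets words"
    unfolding sets_words mem_Collect_eq v by auto
  have "emeasure words {[]} = (\<Sum>n. if n = 0 then 1 else 0)"
    unfolding emeasure_words[OF s] v
    by (intro suminf_cong) (auto simp: prob_space.emeasure_space_1[OF prob_space_cube])
  also have "\<dots> = 1" by (subst suminf_finite[of "{0}"]) auto
  finally show "emeasure words {[]} = 1" .
qed

instantiation F1 :: ("{real_normed_field,banach,second_countable_topology}") real_normed_algebra_1
begin

lift_definition times_F1 :: "'a F1 \<Rightarrow> 'a F1 \<Rightarrow> 'a F1" is concat_prod
  unfolding ae_rel_def by (intro conjI integrable_concat_prod AE_splits) (auto simp: ae_rel_def)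

lift_definition one_F1 :: "'a F1" is "indicator {[]}"
  by (simp add: ae_rel_def integrable_indicator_words sets_words_Nil emeasure_words_Nil)

instance
proof
  fix f g h :: "'a F1" and c :: real
  show "f * g * h = f * (g * h)"
    by transfer (simp add: concat_prod_assoc ae_rel_def integrable_concat_prod)
  show "(f + g) * h = f * h + g * h" "f * (g + h) = f * g + f * h"
    by (transfer, simp add: concat_prod_linear ae_rel_def integrable_concat_prod)+
  show "c *\<^sub>R f * g = c *\<^sub>R (f * g)" "f * c *\<^sub>R g = c *\<^sub>R (f * g)"
    by (transfer, simp add: concat_prod_linear ae_rel_def integrable_concat_prod)+
  show "1 * f = f"
  proof transfer
    fix f :: "real list \<Rightarrow> 'a" assume f: "ae_rel f f"
    have "concat_prod (indicator {[]}) f = f"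
    proof
      fix x show "concat_prod (indicator {[]}) f x = f x"
        unfolding concat_prod_def
        by (subst sum.remove[of _ 0]) (auto intro!: sum.neutral)
    qed
    with f show "ae_rel (concat_prod (indicator {[]}) f) f" by simp
  qed
  show "f * 1 = f"
  proof transfer
    fix f :: "real list \<Rightarrow> 'a" assume f: "ae_rel f f"
    have "concat_prod f (indicator {[]}) = f"
    proof
      fix x show "concat_prod f (indicator {[]}) x = f x"
        unfolding concat_prod_def
        by (subst sum.remove[of _ "length x"]) (auto intro!: sum.neutral)
    qed
    with f show "ae_rel (concat_prod f (indicator {[]})) f" by simp
  qed
  show n1: "norm (1 :: 'a F1) = 1"
    by transfer (simp add: integral_norm_indicator_words sets_words_Nil emeasure_words_Nil measure_def)
  show "norm (f * g) \<le> norm f * norm g"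
    by transfer (simp add: ae_rel_def integral_norm_concat_prod)
  have "norm (0 :: 'a F1) \<noteq> norm (1 :: 'a F1)"
    by (simp only: n1 norm_zero)
  then show "(0 :: 'a F1) \<noteq> 1" by metis
qed

end

lemma F1_absolutely_summable_imp_summable:
  fixes X :: "nat \<Rightarrow> 'k::{real_normed_field,banach,second_countable_topology} F1"
  assumes "summable (\<lambda>n. norm (X n))"
  shows "summable X"
proof -
  define u where "u n = rep_F1 (X n)" for n
  have r: "ae_rel (u n) (u n)" and X: "X n = abs_F1 (u n)" for n
    using Quotient3_rep_reflp[OF Quotient3_F1] Quotient3_abs_rep[OF Quotient3_F1]
    unfolding u_def by metis+
  have i [simp]: "integrable words (u n)" for n
    using r by (simp add: ae_rel_def)
  have [measurable]: "u n \<in> borel_measurable words" for n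
    using i by (rule borel_measurable_integrable)
  have N: "norm (abs_F1 f) = (\<integral>x. norm (f x) \<partial>words)" if "integrable words f" for f :: "real list \<Rightarrow> 'k"
    using that by (intro norm_F1.abs_eq) (simp add: ae_rel_def)
  have s: "summable (\<lambda>n. \<integral>x. norm (u n x) \<partial>words)"
    using assms by (simp add: X N)
  have "(\<integral>\<^sup>+ x. (\<Sum>n. ennreal (norm (u n x))) \<partial>words) = (\<Sum>n. \<integral>\<^sup>+ x. norm (u n x) \<partial>words)"
    by (rule nn_integral_suminf) measurable
  also have "\<dots> = (\<Sum>n. ennreal (\<integral>x. norm (u n x) \<partial>words))"
    by (simp add: nn_integral_eq_integral)
  also have "\<dots> < \<infinity>"
    using s by (simp add: ennreal_suminf_neq_top less_top[symmetric])
  finally have "AE x in words. (\<Sum>n. ennreal (norm (u n x))) \<noteq> \<infinity>"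
    by (intro nn_integral_PInf_AE) auto
  then have ae: "AE x in words. summable (\<lambda>n. norm (u n x))"
    by eventually_elim (auto intro!: summable_suminf_not_top)
  define S where "S x = (\<Sum>n. u n x)" for x
  have S: "integrable words S"
    unfolding S_def[abs_def] by (rule integrable_suminf[OF i ae s])
  have P: "(\<Sum>n<m. X n) = abs_F1 (\<lambda>x. \<Sum>n<m. u n x)" for m
  proof (induction m)
    case 0
    then show ?case by (simp add: zero_F1_def)
  next
    case (Suc m)
    then show ?case
      by (simp add: X, subst plus_F1.abs_eq) (auto simp: ae_rel_def)
  qed
  have D: "norm ((\<Sum>n<m. X n) - abs_F1 S) \<le> (\<Sum>n. \<integral>x. norm (u (n + m) x) \<partial>words)" for m
  proof -
    have ae': "AE x in words. summable (\<lambda>n. norm (u (n + m) x))"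
      using ae by eventually_elim (simp add: summable_iff_shift[of "\<lambda>n. norm (u n _)"])
    have s': "summable (\<lambda>n. \<integral>x. norm (u (n + m) x) \<partial>words)"
      using s by (simp add: summable_iff_shift[of "\<lambda>n. \<integral>x. norm (u n x) \<partial>words"])
    have "norm ((\<Sum>n<m. X n) - abs_F1 S) = (\<integral>x. norm ((\<Sum>n<m. u n x) - S x) \<partial>words)"
      unfolding P using S by (subst minus_F1.abs_eq) (auto simp: ae_rel_def intro!: N)
    also have "\<dots> \<le> (\<integral>x. (\<Sum>n. norm (u (n + m) x)) \<partial>words)"
    proof (rule integral_mono_AE)
      show "integrable words (\<lambda>x. norm ((\<Sum>n<m. u n x) - S x))"
        using S by auto
      show "integrable words (\<lambda>x. \<Sum>n. norm (u (n + m) x))"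
        using ae' s' by (intro integrable_suminf) auto
      show "AE x in words. norm ((\<Sum>n<m. u n x) - S x) \<le> (\<Sum>n. norm (u (n + m) x))"
        using ae ae'
      proof eventually_elim
        case (elim x)
        have "S x = (\<Sum>n. u (n + m) x) + (\<Sum>n<m. u n x)"
          unfolding S_def by (rule suminf_split_initial_segment[OF summable_norm_cancel[OF elim(1)]])
        then have "(\<Sum>n<m. u n x) - S x = - (\<Sum>n. u (n + m) x)"
          by simp
        then have "norm ((\<Sum>n<m. u n x) - S x) = norm (\<Sum>n. u (n + m) x)"
          by (simp only: norm_minus_cancel)
        also have "\<dots> \<le> (\<Sum>n. norm (u (n + m) x))"
          using elim(2) by (rule summable_norm)
        finally show ?case .
      qed
    qed
    also have "\<dots> = (\<Sum>n. \<integral>x. norm (u (n + m) x) \<partial>words)"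
      using ae' s' by (intro integral_suminf) auto
    finally show ?thesis .
  qed
  have "(\<lambda>m. (\<Sum>n. \<integral>x. norm (u (n + m) x) \<partial>words)) \<longlonglongrightarrow> 0"
    by (rule suminf_exist_split2[OF s])
  then have "(\<lambda>m. (\<Sum>n<m. X n) - abs_F1 S) \<longlonglongrightarrow> 0"
    by (rule Lim_null_comparison[rotated]) (simp add: D)
  then have "X sums abs_F1 S"
    unfolding sums_def by (subst Lim_null)
  then show ?thesis by (rule sums_summable)
qed

instance F1 :: ("{real_normed_field,banach,second_countable_topology}") banach
proof
  fix X :: "nat \<Rightarrow> 'a F1" assume "Cauchy X"
  have "\<exists>r. strict_mono r \<and> (\<forall>n. dist (X (r (Suc n))) (X (r n)) < (1 / 2) ^ n)"
  proof -
    have "\<exists>M. \<forall>m\<ge>M. \<forall>n\<ge>M. dist (X m) (X n) < (1 / 2) ^ k" for k :: nat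
      using \<open>Cauchy X\<close> by (rule metric_CauchyD) simp
    then obtain M where M: "\<And>k m n. m \<ge> M k \<Longrightarrow> n \<ge> M k \<Longrightarrow> dist (X m) (X n) < (1 / 2) ^ k"
      by metis
    define r where "r = rec_nat (M 0) (\<lambda>n rn. max (Suc rn) (M (Suc n)))"
    have r: "r 0 = M 0" "r (Suc n) = max (Suc (r n)) (M (Suc n))" for n
      by (simp_all add: r_def)
    have "strict_mono r" by (simp add: strict_mono_Suc_iff r less_max_iff_disj)
    moreover have "M n \<le> r n" for n by (cases n) (simp_all add: r)
    moreover have "r n \<le> r (Suc n)" for n by (simp add: r le_max_iff_disj)
    ultimately show ?thesis using M by (metis order_trans)
  qed
  then obtain r where r: "strict_mono r" "\<And>n. dist (X (r (Suc n))) (X (r n)) < (1 / 2) ^ n"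
    by blast
  have "summable (\<lambda>n. norm (X (r (Suc n)) - X (r n)))"
    using r(2) by (intro summable_comparison_test'[OF summable_geometric[of "1 / 2 :: real"]])
      (auto simp: dist_norm less_imp_le)
  then have "summable (\<lambda>n. X (r (Suc n)) - X (r n))"
    by (rule F1_absolutely_summable_imp_summable)
  then have "convergent (\<lambda>n. \<Sum>i<n. X (r (Suc i)) - X (r i))"
    by (simp add: summable_iff_convergent)
  then have "convergent (\<lambda>n. X (r n) - X (r 0))"
    by (simp add: sum_lessThan_telescope[of "\<lambda>n. X (r n)"])
  then obtain L where "(\<lambda>n. X (r n) - X (r 0)) \<longlonglongrightarrow> L"
    by (auto simp: convergent_def)
  then have "(\<lambda>n. X (r n) - X (r 0) + X (r 0)) \<longlonglongrightarrow> L + X (r 0)"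
    by (intro tendsto_intros)
  then have "(X \<circ> r) \<longlonglongrightarrow> L + X (r 0)" by (simp add: o_def)
  with \<open>Cauchy X\<close> r(1) have "X \<longlonglongrightarrow> L + X (r 0)" by (rule Cauchy_converges_subseq)
  then show "convergent X" by (rule convergentI)
qed


section \<open>The measure \<open>Z\<^sup>1\<close>\<close>

text \<open>
  Only values at Borel subsets of \<open>[0,1)\<close> are meaningful; for other sets the function under
  \<^const>\<open>abs_F1\<close> is not a representative.
\<close>

definition Z1 :: "real set \<Rightarrow> 'k::{real_normed_field,banach,second_countable_topology} F1" where
  "Z1 J = abs_F1 (indicator ((\<lambda>t. [t]) ` J))"

lemma
  assumes J: "J \<in> sets borel" "J \<subseteq> {0..<1}"
  shows sets_words_singletons: "(\<lambda>t. [t]) ` J \<in> sets words"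
    and emeasure_words_singletons: "emeasure words ((\<lambda>t. [t]) ` J) = emeasure lborel J"
proof -
  have v: "word n -` ((\<lambda>t. [t]) ` J) \<inter> space (cube n) = (if n = 1 then PiE {..<1} (\<lambda>_. J) else {})" for n
  proof (cases "n = 1")
    case True
    have "t \<in> word 1 -` ((\<lambda>t. [t]) ` J) \<inter> space (cube 1) \<longleftrightarrow> t \<in> PiE {..<1} (\<lambda>_. J)" for t
    proof -
      have "word 1 t = [t 0]" by (simp add: word_def)
      then have "t \<in> word 1 -` ((\<lambda>t. [t]) ` J) \<longleftrightarrow> t 0 \<in> J" by auto
      then show ?thesis
        using J(2) by (auto simp: cube_def space_PiM PiE_iff)
    qed
    then have "word 1 -` ((\<lambda>t. [t]) ` J) \<inter> space (cube 1) = PiE {..<1} (\<lambda>_. J)" by blast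
    then show ?thesis by (simp only: True if_True simp_thms)
  next
    case False
    have "word n t \<noteq> [s]" for s t
    proof
      assume "word n t = [s]"
      then have "length (word n t) = 1" by simp
      with False show False by (simp add: word_def)
    qed
    then have "word n -` ((\<lambda>t. [t]) ` J) \<inter> space (cube n) = {}" by blast
    then show ?thesis by (simp only: False if_False)
  qed
  have JU: "J \<in> sets unit_interval"
    using J by (simp add: unit_interval_def sets_restrict_space_iff)
  then have c: "PiE {..<1} (\<lambda>_. J) \<in> sets (cube 1)"
    unfolding cube_def by (intro sets_PiM_I_finite) auto
  show s: "(\<lambda>t. [t]) ` J \<in> sets words"
    unfolding sets_words mem_Collect_eq v using J(2) c by auto
  have "emeasure words ((\<lambda>t. [t]) ` J)
      = (\<Sum>n. if n = 1 then emeasure (cube 1) (PiE {..<1} (\<lambda>_. J)) else 0)"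
    unfolding emeasure_words[OF s] v by (intro suminf_cong) auto
  also have "\<dots> = emeasure (cube 1) (PiE {..<1} (\<lambda>_. J))"
    by (subst suminf_finite[of "{1}"]) auto
  also have "\<dots> = emeasure unit_interval J"
    unfolding cube_def using JU by (subst unit_interval.emeasure_PiM) auto
  also have "\<dots> = emeasure lborel J"
    using J by (simp add: unit_interval_def emeasure_restrict_space)
  finally show "emeasure words ((\<lambda>t. [t]) ` J) = emeasure lborel J" .
qed

lemma ae_rel_Z1:
  assumes "J \<in> sets borel" "J \<subseteq> {0..<1}"
  shows "ae_rel (indicator ((\<lambda>t. [t]) ` J) :: real list \<Rightarrow> 'k::{real_normed_field,banach,second_countable_topology})
           (indicator ((\<lambda>t. [t]) ` J))"
proof -
  have "emeasure lborel J \<le> emeasure lborel {0..<1::real}"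
    using assms by (intro emeasure_mono) auto
  then show ?thesis
    using sets_words_singletons[OF assms] emeasure_words_singletons[OF assms]
    by (auto simp: ae_rel_def le_less_trans intro!: integrable_indicator_words)
qed

lemma norm_Z1:
  assumes "J \<in> sets borel" "J \<subseteq> {0..<1}"
  shows "norm (Z1 J :: 'k::{real_normed_field,banach,second_countable_topology} F1) = measure lborel J"
proof -
  have "emeasure lborel J \<le> emeasure lborel {0..<1::real}"
    using assms by (intro emeasure_mono) auto
  then have "emeasure words ((\<lambda>t. [t]) ` J) < \<infinity>"
    by (auto simp: emeasure_words_singletons[OF assms] le_less_trans)
  then show ?thesis
    unfolding Z1_def
    by (simp add: norm_F1.abs_eq[OF ae_rel_Z1[OF assms]] integral_norm_indicator_words
        sets_words_singletons[OF assms] measure_def emeasure_words_singletons[OF assms])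
qed

lemma Z1_Un:
  assumes "A \<in> sets borel" "A \<subseteq> {0..<1}" "B \<in> sets borel" "B \<subseteq> {0..<1}" "A \<inter> B = {}"
  shows "(Z1 (A \<union> B) :: 'k::{real_normed_field,banach,second_countable_topology} F1) = Z1 A + Z1 B"
proof -
  have "(indicator ((\<lambda>t. [t]) ` (A \<union> B)) :: real list \<Rightarrow> 'k)
      = (\<lambda>x. indicator ((\<lambda>t. [t]) ` A) x + indicator ((\<lambda>t. [t]) ` B) x)"
    using assms(5) by (auto simp: fun_eq_iff split: split_indicator)
  then show ?thesis
    unfolding Z1_def using assms by (simp add: plus_F1.abs_eq ae_rel_Z1)
qed

section \<open>Variation and the Magnus expansion of interval measures\<close>

text \<open>
  A measure \<open>\<phi>\<close> on an interval \<open>I\<close> is given as a function of sets, evaluated at subintervals of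
  \<open>I\<close> only.
\<close>

definition variation :: "real set \<Rightarrow> (real set \<Rightarrow> 'a::real_normed_vector) \<Rightarrow> ennreal" where
  "variation I \<phi> = (SUP P \<in> {P. finite P \<and> disjoint P \<and> (\<forall>J\<in>P. is_interval J \<and> J \<subseteq> I)}.
     \<Sum>J\<in>P. ennreal (norm (\<phi> J)))"

definition asc :: "nat \<Rightarrow> (nat \<Rightarrow> nat) \<Rightarrow> nat" where
  "asc k \<sigma> = card {i \<in> {1..<k}. \<sigma> i < \<sigma> (i + 1)}"

definition des :: "nat \<Rightarrow> (nat \<Rightarrow> nat) \<Rightarrow> nat" where
  "des k \<sigma> = card {i \<in> {1..<k}. \<sigma> i > \<sigma> (i + 1)}"

definition magnus_commutator :: "nat \<Rightarrow> (nat \<Rightarrow> 'a::real_normed_algebra_1) \<Rightarrow> 'a" where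
  "magnus_commutator k X = (\<Sum>\<sigma> | \<sigma> permutes {1..k}.
     ((-1) ^ des k \<sigma> * (fact (asc k \<sigma>) * fact (des k \<sigma>) / fact k)) *\<^sub>R
     prod_list (map (\<lambda>i. X (\<sigma> i)) [1..<k + 1]))"

definition interval_partitions :: "real set \<Rightarrow> real set set set" where
  "interval_partitions I = {P. finite P \<and> partition_on I P \<and> (\<forall>J\<in>P. is_interval J)}"

definition refining :: "real set \<Rightarrow> real set set filter" where
  "refining I = (INF P \<in> interval_partitions I. principal {Q \<in> interval_partitions I. refines I Q P})"

lemma eventually_refining:
  assumes "is_interval I"
  shows "eventually \<Phi> (refining I) \<longleftrightarrow>
    (\<exists>P\<in>interval_partitions I. \<forall>Q\<in>interval_partitions I. refines I Q P \<longrightarrow> \<Phi> Q)"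
proof -
  have "(if I = {} then {} else {I}) \<in> interval_partitions I"
    using assms by (auto simp: interval_partitions_def partition_on_def)
  then have ne: "interval_partitions I \<noteq> {}" by blast
  have dir: "\<exists>R\<in>interval_partitions I. refines I R P \<and> refines I R Q"
    if P: "P \<in> interval_partitions I" and Q: "Q \<in> interval_partitions I" for P Q
  proof
    have p: "\<And>S. S \<in> {P, Q} \<Longrightarrow> partition_on I S"
      using P Q by (auto simp: interval_partitions_def)
    show "refines I (common_refinement {P, Q}) P \<and> refines I (common_refinement {P, Q}) Q"
      using p by (intro conjI refines_common_refinement) auto
    have sub: "common_refinement {P, Q} \<subseteq> (\<lambda>(A, B). A \<inter> B) ` (P \<times> Q)"
      by (force simp: common_refinement)
    have "finite (common_refinement {P, Q})"
      using P Q by (intro finite_subset[OF sub]) (auto simp: interval_partitions_def)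
    moreover have "is_interval J" if "J \<in> common_refinement {P, Q}" for J
    proof -
      from that sub obtain A B where "J = A \<inter> B" "A \<in> P" "B \<in> Q" by auto
      with P Q show ?thesis by (simp add: interval_partitions_def is_interval_Int)
    qed
    ultimately show "common_refinement {P, Q} \<in> interval_partitions I"
      using partition_on_common_refinement[of "{P, Q}", OF p] by (auto simp: interval_partitions_def)
  qed
  have "eventually \<Phi> (refining I) \<longleftrightarrow>
      (\<exists>P\<in>interval_partitions I. eventually \<Phi> (principal {Q \<in> interval_partitions I. refines I Q P}))"
    unfolding refining_def
  proof (rule eventually_INF_base[OF ne])
    fix P Q assume "P \<in> interval_partitions I" "Q \<in> interval_partitions I"
    then obtain R where "R \<in> interval_partitions I" "refines I R P" "refines I R Q"
      using dir by blast
    then show "\<exists>R\<in>interval_partitions I. principal {S \<in> interval_partitions I. refines I S R}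
        \<le> inf (principal {S \<in> interval_partitions I. refines I S P})
            (principal {S \<in> interval_partitions I. refines I S Q})"
      by (intro bexI[of _ R]) (auto intro: refines_trans)
  qed
  then show ?thesis by (auto simp: eventually_principal)
qed

lemma refining_neq_bot:
  assumes "is_interval I"
  shows "refining I \<noteq> bot"
  unfolding trivial_limit_def eventually_refining[OF assms]
  by (auto simp: interval_partitions_def intro: refines_refl)

text \<open>
  The integral of \<open>F (\<phi> t\<^sub>1) \<dots> (\<phi> t\<^sub>k)\<close> over \<open>t\<^sub>1 \<le> \<dots> \<le> t\<^sub>k\<close> in \<open>I\<close>, for \<open>F\<close> additive in each of its \<open>k\<close>
  arguments: a partition of \<open>I\<close> cuts \<open>I\<^sup>k\<close> into boxes \<open>s 1 \<times> \<dots> \<times> s k\<close>, the values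
  \<open>F (\<phi> (s 1)) \<dots> (\<phi> (s k))\<close> at the boxes meeting the simplex are summed up, and the partition
  gets finer and finer.
\<close>

definition simplex_integral :: "nat \<Rightarrow> real set \<Rightarrow> ((nat \<Rightarrow> 'a) \<Rightarrow> 'a) \<Rightarrow> (real set \<Rightarrow> 'a) \<Rightarrow> 'a::real_normed_vector" where
  "simplex_integral k I F \<phi> = Lim (refining I)
     (\<lambda>P. \<Sum>s | s \<in> {1..k} \<rightarrow>\<^sub>E P \<and> (\<exists>t \<in> PiE {1..k} s. mono_on {1..k} t). F (\<lambda>i. \<phi> (s i)))"

lemma simplex_integral_eqI:
  assumes "is_interval I"
    and "((\<lambda>P. \<Sum>s | s \<in> {1..k} \<rightarrow>\<^sub>E P \<and> (\<exists>t \<in> PiE {1..k} s. mono_on {1..k} t). F (\<lambda>i. \<phi> (s i))) \<longlongrightarrow> L)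
      (refining I)"
  shows "simplex_integral k I F \<phi> = L"
  unfolding simplex_integral_def using assms refining_neq_bot by (intro tendsto_Lim)

definition magnus_term :: "nat \<Rightarrow> real set \<Rightarrow> (real set \<Rightarrow> 'a) \<Rightarrow> 'a::real_normed_algebra_1" where
  "magnus_term k I \<phi> = simplex_integral k I (magnus_commutator k) \<phi>"

end

theory Submission
  imports Defs
begin

text \<open>
  The Riemann sums of the degree \<open>k\<close> term converge in \<open>L\<^sup>1\<close> to \<open>2\<^sup>k\<close> times the function on \<open>[0,1)\<^sup>k\<close>
  which at a point with distinct coordinates takes the coefficient of the rank permutation of the
  coordinates: away from the points with two coordinates in a common block of the partition they
  agree with it exactly. Since \<open>asc! des! / k! = 1 / (k (k - 1 choose asc)) \<ge> 1 / (k 2\<^sup>k\<^sup>-\<^sup>1)\<close>, the term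
  has norm at least \<open>2 / k\<close>. The norm is additive over the degrees, so convergence of the expansion
  would force convergence of the harmonic series.
\<close>

text \<open>The obstacle is the diagonal: a box with a repeated block meets the simplex and is
  counted in full for every permutation, so boxes of different permutations overlap there. The mass
  of this overlap is controlled without computing a product measure. Submultiplicativity of the norm
  bounds the volume of a box, so a pair of positions costs at most the sum of |J|^2 over the blocks
  J, hence at most the mesh. The same majorant disposes of the words with repeated letters when the
  norm is bounded below. Off the diagonal the regions belonging to different permutations are
  disjoint. Therefore the alternating signs cannot cancel, and a pointwise bound on the coefficients
  bounds the norm. The factor 2 balances the bound 2^(k-1) on the binomial coefficients: with c >= 0
  in its place the lower bound reads 2 (c/2)^k / k, which is summable exactly for c < 2.\<close>

section \<open>Representatives of elements of \<open>F1\<close>\<close>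

lemma ae_rel_refl_iff: "ae_rel f f \<longleftrightarrow> integrable words f"
  by (simp add: ae_rel_def)

lemma norm_abs_F1: "integrable words f \<Longrightarrow> norm (abs_F1 f) = (\<integral>x. norm (f x) \<partial>words)"
  by (intro norm_F1.abs_eq) (simp add: ae_rel_refl_iff)

lemma abs_F1_diff:
  "integrable words f \<Longrightarrow> integrable words g \<Longrightarrow> abs_F1 f - abs_F1 g = abs_F1 (\<lambda>x. f x - g x)"
  by (intro minus_F1.abs_eq) (simp_all add: ae_rel_refl_iff)

lemma abs_F1_scaleR: "integrable words f \<Longrightarrow> c *\<^sub>R abs_F1 f = abs_F1 (\<lambda>x. c *\<^sub>R f x)"
  by (intro scaleR_F1.abs_eq) (simp_all add: ae_rel_refl_iff)

lemma abs_F1_sum: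
  assumes "finite A" "\<And>i. i \<in> A \<Longrightarrow> integrable words (f i)"
  shows "(\<Sum>i\<in>A. abs_F1 (f i)) = abs_F1 (\<lambda>x. \<Sum>i\<in>A. f i x)"
  using assms
proof (induction rule: finite_induct)
  case empty
  then show ?case by (simp add: zero_F1_def)
next
  case (insert i A)
  then show ?case
    by simp (intro plus_F1.abs_eq, auto simp: ae_rel_refl_iff)
qed

section \<open>Products of values of \<open>Z1\<close> as indicators of boxes\<close>

lemma mem_listset_iff: "x \<in> listset As \<longleftrightarrow> list_all2 (\<in>) x As"
  by (induction As arbitrary: x) (auto simp: set_Cons_def list_all2_Cons2)

text \<open>The left factor lives on one-letter words, so among all cuts of a word only the one
  after its first letter contributes.\<close>

lemma concat_prod_indicator_singletons:
  "concat_prod (indicator ((\<lambda>t. [t]) ` A)) (indicator (listset As))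
    = (indicator (listset (A # As)) :: real list \<Rightarrow> 'k::real_normed_field)"
proof
  fix x :: "real list"
  have "concat_prod (indicator ((\<lambda>t. [t]) ` A)) (indicator (listset As)) x
      = (\<Sum>i\<in>{..length x} \<inter> {1}. indicator ((\<lambda>t. [t]) ` A) (take i x) * indicator (listset As) (drop i x) :: 'k)"
    unfolding concat_prod_def
  proof (rule sum.mono_neutral_right)
    show "\<forall>i\<in>{..length x} - {..length x} \<inter> {1}.
        indicator ((\<lambda>t. [t]) ` A) (take i x) * indicator (listset As) (drop i x) = (0 :: 'k)"
    proof
      fix i assume i: "i \<in> {..length x} - {..length x} \<inter> {1}"
      have "take i x \<noteq> [t]" for t
      proof
        assume "take i x = [t]"
        then have "length (take i x) = 1" by simp
        with i show False by auto
      qed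
      then show "indicator ((\<lambda>t. [t]) ` A) (take i x) * indicator (listset As) (drop i x) = (0 :: 'k)"
        by (auto simp: indicator_def)
    qed
  qed auto
  also have "\<dots> = indicator (listset (A # As)) x"
    by (cases x) (auto simp: set_Cons_def indicator_def)
  finally show "concat_prod (indicator ((\<lambda>t. [t]) ` A)) (indicator (listset As)) x
    = (indicator (listset (A # As)) x :: 'k)" .
qed

text \<open>Both claims go through the same induction: integrability of the box indicator is
  inherited from the concatenation product, so measurability of boxes never has to be checked by
  hand.\<close>

lemma
  assumes "\<And>A. A \<in> set As \<Longrightarrow> A \<in> sets borel \<and> A \<subseteq> {0..<1}"
  shows integrable_indicator_listset:
      "integrable words (indicator (listset As) :: real list \<Rightarrow> 'k::{real_normed_field,banach,second_countable_topology})"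
    and prod_list_Z1: "prod_list (map Z1 As) = abs_F1 (indicator (listset As) :: real list \<Rightarrow> 'k)"
proof -
  have "integrable words (indicator (listset As) :: real list \<Rightarrow> 'k)
      \<and> prod_list (map Z1 As) = abs_F1 (indicator (listset As) :: real list \<Rightarrow> 'k)"
    using assms
  proof (induction As)
    case Nil
    then show ?case
      by (simp add: one_F1_def integrable_indicator_words sets_words_Nil emeasure_words_Nil)
  next
    case (Cons A As)
    have A: "ae_rel (indicator ((\<lambda>t. [t]) ` A) :: real list \<Rightarrow> 'k) (indicator ((\<lambda>t. [t]) ` A))"
      using Cons.prems by (intro ae_rel_Z1) auto
    have IH: "integrable words (indicator (listset As) :: real list \<Rightarrow> 'k)"
        "prod_list (map Z1 As) = abs_F1 (indicator (listset As) :: real list \<Rightarrow> 'k)"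
      using Cons by auto
    have "integrable words (concat_prod (indicator ((\<lambda>t. [t]) ` A)) (indicator (listset As)) :: real list \<Rightarrow> 'k)"
      using A IH(1) by (intro integrable_concat_prod) (auto simp: ae_rel_refl_iff)
    moreover have "Z1 A * prod_list (map Z1 As)
        = abs_F1 (concat_prod (indicator ((\<lambda>t. [t]) ` A)) (indicator (listset As)) :: real list \<Rightarrow> 'k)"
      unfolding IH(2) Z1_def using A IH(1) by (intro times_F1.abs_eq) (auto simp: ae_rel_refl_iff)
    ultimately show ?case unfolding concat_prod_indicator_singletons by simp
  qed
  then show "integrable words (indicator (listset As) :: real list \<Rightarrow> 'k)"
    "prod_list (map Z1 As) = abs_F1 (indicator (listset As) :: real list \<Rightarrow> 'k)" by auto
qed

text \<open>The integral is the norm of a product in \<open>real F1\<close>, and submultiplicativity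
  of that norm gives the bound. An upper bound is all that the error estimate requires.\<close>

lemma integral_indicator_listset_le:
  assumes "\<And>A. A \<in> set As \<Longrightarrow> A \<in> sets borel \<and> A \<subseteq> {0..<1}"
  shows "(\<integral>x. indicator (listset As) x \<partial>words) \<le> prod_list (map (measure lborel) As)"
proof -
  have "norm (prod_list (map Z1 As) :: real F1) \<le> prod_list (map (measure lborel) As)"
    using assms
  proof (induction As)
    case (Cons A As)
    have "norm (Z1 A * prod_list (map Z1 As) :: real F1)
        \<le> norm (Z1 A :: real F1) * norm (prod_list (map Z1 As) :: real F1)"
      by (rule norm_mult_ineq)
    also have "\<dots> \<le> measure lborel A * prod_list (map (measure lborel) As)"
      using Cons by (intro mult_mono) (auto simp: norm_Z1)
    finally show ?case by simp
  qed simp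
  then show ?thesis
    by (simp add: prod_list_Z1[OF assms] norm_abs_F1 integrable_indicator_listset[OF assms])
qed

lemma prod_list_scaleR:
  fixes X :: "'b \<Rightarrow> 'a::real_normed_algebra_1"
  shows "prod_list (map (\<lambda>i. c *\<^sub>R X i) xs) = c ^ length xs *\<^sub>R prod_list (map X xs)"
  by (induction xs) simp_all

definition magnus_coeff :: "nat \<Rightarrow> (nat \<Rightarrow> nat) \<Rightarrow> real" where
  "magnus_coeff k \<sigma> = (-1) ^ des k \<sigma> * (fact (asc k \<sigma>) * fact (des k \<sigma>) / fact k)"

text \<open>Gives one summand of a Riemann sum an explicit representative, so that later estimates
  can be made pointwise in the word. Each product has \<open>k\<close> factors, whence the power of
  \<open>c\<close>.\<close>

lemma magnus_commutator_Z1: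
  assumes "\<And>i. i \<in> {1..k} \<Longrightarrow> s i \<in> sets borel \<and> s i \<subseteq> {0..<1}"
  shows "magnus_commutator k (\<lambda>i. c *\<^sub>R Z1 (s i)) = abs_F1 (\<lambda>x. c ^ k *\<^sub>R (\<Sum>\<sigma> | \<sigma> permutes {1..k}.
    magnus_coeff k \<sigma> *\<^sub>R (indicator (listset (map (\<lambda>i. s (\<sigma> i)) [1..<k + 1])) x
      :: 'k::{real_normed_field,banach,second_countable_topology})))"
proof -
  let ?B = "\<lambda>\<sigma>. map (\<lambda>i. s (\<sigma> i)) [1..<k + 1]"
  have B: "A \<in> sets borel \<and> A \<subseteq> {0..<1}" if \<sigma>: "\<sigma> permutes {1..k}" and A: "A \<in> set (?B \<sigma>)" for \<sigma> A
  proof -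
    from A have "A \<in> (\<lambda>i. s (\<sigma> i)) ` {1..k}" by (auto simp: image_iff Bex_def)
    with assms permutes_in_image[OF \<sigma>] show ?thesis by blast
  qed
  have int: "integrable words (indicator (listset (?B \<sigma>)) :: real list \<Rightarrow> 'k)" if "\<sigma> permutes {1..k}" for \<sigma>
    by (rule integrable_indicator_listset[OF B[OF that]])
  have "magnus_commutator k (\<lambda>i. c *\<^sub>R Z1 (s i)) = (\<Sum>\<sigma> | \<sigma> permutes {1..k}.
      abs_F1 (\<lambda>x. c ^ k *\<^sub>R (magnus_coeff k \<sigma> *\<^sub>R (indicator (listset (?B \<sigma>)) x :: 'k))))"
    unfolding magnus_commutator_def
  proof (intro sum.cong refl)
    fix \<sigma> assume \<sigma>: "\<sigma> \<in> {\<sigma>. \<sigma> permutes {1..k}}"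
    have "prod_list (map (\<lambda>i. c *\<^sub>R Z1 (s (\<sigma> i))) [1..<k + 1])
        = c ^ k *\<^sub>R (prod_list (map Z1 (?B \<sigma>)) :: 'k F1)"
      by (simp only: prod_list_scaleR map_map o_def length_upt add_diff_cancel_right')
    also have "\<dots> = c ^ k *\<^sub>R abs_F1 (indicator (listset (?B \<sigma>)))"
      using \<sigma> B by (subst prod_list_Z1) auto
    finally show "((-1) ^ des k \<sigma> * (fact (asc k \<sigma>) * fact (des k \<sigma>) / fact k)) *\<^sub>R
        prod_list (map (\<lambda>i. c *\<^sub>R Z1 (s (\<sigma> i))) [1..<k + 1])
      = abs_F1 (\<lambda>x. c ^ k *\<^sub>R (magnus_coeff k \<sigma> *\<^sub>R (indicator (listset (?B \<sigma>)) x :: 'k)))"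
      using int[of \<sigma>] \<sigma> by (simp add: abs_F1_scaleR magnus_coeff_def mult.commute)
  qed
  also have "\<dots> = abs_F1 (\<lambda>x. \<Sum>\<sigma> | \<sigma> permutes {1..k}.
      c ^ k *\<^sub>R (magnus_coeff k \<sigma> *\<^sub>R (indicator (listset (?B \<sigma>)) x :: 'k)))"
    using int by (intro abs_F1_sum) (auto simp: finite_permutations)
  finally show ?thesis by (simp add: scaleR_sum_right)
qed

section \<open>Series with terms in different degrees\<close>

lemma norm_sum_disjoint_support:
  fixes u :: "'i \<Rightarrow> 'b \<Rightarrow> 'a::real_normed_vector"
  assumes "finite A" "\<And>i j. i \<in> A \<Longrightarrow> j \<in> A \<Longrightarrow> u i x \<noteq> 0 \<Longrightarrow> u j x \<noteq> 0 \<Longrightarrow> i = j"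
  shows "norm (\<Sum>i\<in>A. u i x) = (\<Sum>i\<in>A. norm (u i x))"
proof (cases "\<exists>i\<in>A. u i x \<noteq> 0")
  case True
  then obtain i where i: "i \<in> A" "u i x \<noteq> 0" by blast
  with assms have "u j x = 0" if "j \<in> A - {i}" for j using that by blast
  then show ?thesis
    using assms(1) i(1) by (simp add: sum.remove[of A i])
qed simp

text \<open>Components of different degrees have disjoint supports, so the norm is additive over them.\<close>

lemma summable_homogeneous_iff:
  fixes u :: "nat \<Rightarrow> real list \<Rightarrow> 'k::{real_normed_field,banach,second_countable_topology}"
  assumes int: "\<And>k. integrable words (u k)"
    and deg: "\<And>k x. u k x \<noteq> 0 \<Longrightarrow> length x = d k" and "inj d"
  shows "summable (\<lambda>k. abs_F1 (u k)) \<longleftrightarrow> summable (\<lambda>k. norm (abs_F1 (u k)))"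
proof -
  \<comment> \<open>Equality on every segment makes the Cauchy criteria of the two series coincide.
    The outer real norm on the right only matches the shape of
    \<open>summable_Cauchy\<close>.\<close>
  have "norm (\<Sum>k=m..<n. abs_F1 (u k)) = norm (\<Sum>k=m..<n. norm (abs_F1 (u k)))" for m n
  proof -
    have "norm (\<Sum>k=m..<n. abs_F1 (u k)) = (\<integral>x. norm (\<Sum>k=m..<n. u k x) \<partial>words)"
      using int by (simp add: abs_F1_sum norm_abs_F1)
    also have "\<dots> = (\<integral>x. (\<Sum>k=m..<n. norm (u k x)) \<partial>words)"
      using \<open>inj d\<close> deg
      by (intro Bochner_Integration.integral_cong refl norm_sum_disjoint_support) (auto dest!: deg simp: inj_eq)
    also have "\<dots> = (\<Sum>k=m..<n. norm (abs_F1 (u k)))"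
      using int by (simp add: norm_abs_F1)
    finally show ?thesis by (simp add: sum_nonneg)
  qed
  then show ?thesis by (simp add: summable_Cauchy)
qed

section \<open>Variation\<close>

lemma sum_measure_intervals_le:
  assumes "finite P" "disjoint P" "\<And>J. J \<in> P \<Longrightarrow> is_interval J \<and> J \<subseteq> {0..<1::real}"
  shows "(\<Sum>J\<in>P. measure lborel J) \<le> 1"
proof -
  have b: "J \<in> sets borel" if "J \<in> P" for J
    using assms(3)[OF that] by (auto intro: real_interval_borel_measurable)
  have e: "emeasure lborel J \<le> emeasure lborel {0..<1::real}" if "J \<subseteq> {0..<1}" for J :: "real set"
    using that by (intro emeasure_mono) auto
  have "(\<Sum>J\<in>P. measure lborel J) = measure lborel (\<Union>J\<in>P. J)"
  proof (rule measure_finite_Union[symmetric])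
    show "disjoint_family_on (\<lambda>J. J) P"
      using assms(2) by (auto simp: disjoint_family_on_def disjnt_def pairwise_def)
    show "emeasure lborel J \<noteq> \<infinity>" if "J \<in> P" for J
      using e[of J] assms(3)[OF that] by (auto simp: top_unique)
  qed (use b assms in auto)
  also have "\<dots> \<le> measure lborel {0..<1::real}"
    using assms b by (intro measure_mono_fmeasurable) (auto simp: fmeasurable_def)
  finally show ?thesis by simp
qed

lemma variation_scaleR_Z1:
  assumes "c \<ge> 0"
  shows "variation {0..<1} (\<lambda>J. c *\<^sub>R Z1 J :: 'k::{real_normed_field,banach,second_countable_topology} F1) = ennreal c"
  unfolding variation_def
proof (rule antisym)
  have n: "norm (c *\<^sub>R Z1 J :: 'k F1) = c * measure lborel J" if "is_interval J" "J \<subseteq> {0..<1}" for J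
    using that assms by (simp add: norm_Z1 real_interval_borel_measurable)
  let ?P = "{P. finite P \<and> disjoint P \<and> (\<forall>J\<in>P. is_interval J \<and> J \<subseteq> {0..<1::real})}"
  show "(SUP P\<in>?P. \<Sum>J\<in>P. ennreal (norm (c *\<^sub>R Z1 J :: 'k F1))) \<le> ennreal c"
  proof (rule SUP_least)
    fix P assume P: "P \<in> ?P"
    have "(\<Sum>J\<in>P. ennreal (norm (c *\<^sub>R Z1 J :: 'k F1))) = (\<Sum>J\<in>P. ennreal (c * measure lborel J))"
      using P by (intro sum.cong arg_cong[where f = ennreal] n) auto
    also have "\<dots> = ennreal (c * (\<Sum>J\<in>P. measure lborel J))"
      using assms by (subst sum_ennreal) (auto simp: sum_distrib_left)
    also have "\<dots> \<le> ennreal (c * 1)"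
      using P assms by (intro ennreal_leI mult_left_mono sum_measure_intervals_le) auto
    finally show "(\<Sum>J\<in>P. ennreal (norm (c *\<^sub>R Z1 J :: 'k F1))) \<le> ennreal c" by simp
  qed
  \<comment> \<open>The family with the single member [0,1) attains the supremum.\<close>
  have "ennreal c = (\<Sum>J\<in>{{0..<1::real}}. ennreal (norm (c *\<^sub>R Z1 J :: 'k F1)))"
    using n[of "{0..<1}"] by (simp add: is_interval_def)
  also have "\<dots> \<le> (SUP P\<in>?P. \<Sum>J\<in>P. ennreal (norm (c *\<^sub>R Z1 J :: 'k F1)))"
    by (rule SUP_upper) (auto simp: is_interval_def)
  finally show "ennreal c \<le> (SUP P\<in>?P. \<Sum>J\<in>P. ennreal (norm (c *\<^sub>R Z1 J :: 'k F1)))" .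
qed

section \<open>Rank cells and the limit density\<close>

text \<open>Here \<open>\<sigma> a\<close> is the rank of the letter at position \<open>a\<close>,
  as in the product of the X_\<sigma>(a) the \<open>a\<close>-th factor carries the variable number
  \<open>\<sigma> a\<close> of an increasing tuple. Positions count from 1 and list indices from 0.
  For permutations, strictness keeps words with repeated letters out of every cell.\<close>

definition cell :: "nat \<Rightarrow> (nat \<Rightarrow> nat) \<Rightarrow> real list set" where
  "cell k \<sigma> = {x \<in> lists {0..<1}. length x = k \<and>
     (\<forall>a\<in>{1..k}. \<forall>b\<in>{1..k}. \<sigma> a < \<sigma> b \<longrightarrow> x ! (a - 1) < x ! (b - 1))}"

text \<open>The limit of the Riemann sums up to the factor \<open>c ^ k\<close>. At any word at most
  one summand is nonzero.\<close>

definition magnus_density :: "nat \<Rightarrow> real list \<Rightarrow> 'k::real_normed_field" where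
  "magnus_density k x = (\<Sum>\<sigma> | \<sigma> permutes {1..k}. magnus_coeff k \<sigma> *\<^sub>R indicator (cell k \<sigma>) x)"

lemma magnus_density_eq_0: "length x \<noteq> k \<Longrightarrow> magnus_density k x = 0"
  by (simp add: magnus_density_def cell_def)

lemma
  shows sets_words_length: "{x \<in> lists {0..<1}. length x = n} \<in> sets words" (is "?A \<in> _")
    and emeasure_words_length: "emeasure words {x \<in> lists {0..<1}. length x = n} = 1"
proof -
  have v: "word m -` ?A \<inter> space (cube m) = (if m = n then space (cube m) else {})" for m
    using word_in_lists by (auto simp: word_def)
  show s: "?A \<in> sets words"
    unfolding sets_words mem_Collect_eq v by auto
  have "emeasure words ?A = (\<Sum>m. if m = n then 1 else 0)"
    unfolding emeasure_words[OF s] v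
    by (intro suminf_cong) (auto simp: prob_space.emeasure_space_1[OF prob_space_cube])
  also have "\<dots> = 1"
    by (subst suminf_finite[of "{n}"]) auto
  finally show "emeasure words ?A = 1" .
qed

lemma sets_words_cell: "cell k \<sigma> \<in> sets words"
proof -
  have nth: "word k t ! (a - 1) = t (a - 1)" if "a \<in> {1..k}" for a t
    using that by (auto simp: word_def)
  have v: "word n -` cell k \<sigma> \<inter> space (cube n) = (if n = k then
      {t \<in> space (cube n). \<forall>a\<in>{1..k}. \<forall>b\<in>{1..k}. \<sigma> a < \<sigma> b \<longrightarrow> t (a - 1) < t (b - 1)} else {})" for n
  proof (cases "n = k")
    case True
    have "length (word k t) = k" for t by (simp add: word_def)
    then show ?thesis
      using True word_in_lists[of _ k] by (auto simp: cell_def nth simp del: in_lists_conv_set One_nat_def)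
  next
    case False
    then show ?thesis by (auto simp: cell_def word_def)
  qed
  have t: "(\<lambda>t. t (a - 1)) \<in> borel_measurable (cube k)" if "a \<in> {1..k}" for a
  proof -
    have "(\<lambda>t. t (a - 1)) \<in> cube k \<rightarrow>\<^sub>M unit_interval"
      unfolding cube_def using that by (intro measurable_component_singleton) auto
    then show ?thesis
      unfolding unit_interval_def by (simp add: measurable_restrict_space2_iff)
  qed
  have 1: "{t \<in> space (cube k). \<sigma> a < \<sigma> b \<longrightarrow> t (a - 1) < t (b - 1)} \<in> sets (cube k)"
    if "a \<in> {1..k}" "b \<in> {1..k}" for a b
    using borel_measurable_less[OF t[OF that(1)] t[OF that(2)]] by (cases "\<sigma> a < \<sigma> b") auto
  have 2: "{t \<in> space (cube k). \<forall>b\<in>{1..k}. \<sigma> a < \<sigma> b \<longrightarrow> t (a - 1) < t (b - 1)} \<in> sets (cube k)"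
    if "a \<in> {1..k}" for a
    by (rule sets.sets_Collect_finite_All) (simp_all only: 1 that finite_atLeastAtMost)
  have "{t \<in> space (cube k). \<forall>a\<in>{1..k}. \<forall>b\<in>{1..k}. \<sigma> a < \<sigma> b \<longrightarrow> t (a - 1) < t (b - 1)} \<in> sets (cube k)"
    by (rule sets.sets_Collect_finite_All) (simp_all only: 2 finite_atLeastAtMost)
  then have "word n -` cell k \<sigma> \<inter> space (cube n) \<in> sets (cube n)" for n
    unfolding v by (cases "n = k") (simp_all only: if_True if_False sets.empty_sets simp_thms)
  moreover have "cell k \<sigma> \<subseteq> lists {0..<1}"
    unfolding cell_def by blast
  ultimately show ?thesis
    unfolding sets_words by blast
qed

lemma integrable_magnus_density:
  "integrable words (magnus_density k :: real list \<Rightarrow> 'k::{real_normed_field,banach,second_countable_topology})"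
  unfolding magnus_density_def[abs_def]
proof (intro Bochner_Integration.integrable_sum integrable_scaleR_right integrable_indicator_words sets_words_cell)
  fix \<sigma>
  have "emeasure words (cell k \<sigma>) \<le> emeasure words {x \<in> lists {0..<1}. length x = k}"
    by (intro emeasure_mono sets_words_length) (auto simp: cell_def)
  then show "emeasure words (cell k \<sigma>) < \<infinity>"
    by (simp add: emeasure_words_length le_less_trans)
qed

section \<open>Size of the coefficients and of the density\<close>

lemma asc_add_des:
  assumes "\<sigma> permutes {1..k}"
  shows "asc k \<sigma> + des k \<sigma> = k - 1"
proof -
  have "asc k \<sigma> + des k \<sigma> = card ({i \<in> {1..<k}. \<sigma> i < \<sigma> (i + 1)} \<union> {i \<in> {1..<k}. \<sigma> i > \<sigma> (i + 1)})"
    unfolding asc_def des_def by (subst card_Un_disjoint) auto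
  also have "{i \<in> {1..<k}. \<sigma> i < \<sigma> (i + 1)} \<union> {i \<in> {1..<k}. \<sigma> i > \<sigma> (i + 1)} = {1..<k}"
  proof -
    have "\<sigma> i \<noteq> \<sigma> (i + 1)" for i
      using permutes_inj[OF assms] by (simp add: inj_eq)
    then show ?thesis by (auto simp: neq_iff)
  qed
  finally show ?thesis by simp
qed

text \<open>Ascents and descents add up to \<open>n\<close>, so the weight is the inverse of
  \<open>Suc n\<close> times a binomial coefficient of row \<open>n\<close>. Bounding that by the
  row sum is crude but affordable, since the scaling by \<open>2 ^ Suc n\<close> makes up for
  it.\<close>

lemma abs_magnus_coeff_ge:
  assumes "\<sigma> permutes {1..Suc n}"
  shows "1 / (real (Suc n) * 2 ^ n) \<le> \<bar>magnus_coeff (Suc n) \<sigma>\<bar>"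
proof -
  let ?a = "asc (Suc n) \<sigma>" and ?d = "des (Suc n) \<sigma>"
  have ad: "?a + ?d = n" using asc_add_des[OF assms] by simp
  have "fact ?a * fact ?d * (n choose ?a) = fact n"
    using binomial_fact_lemma[of ?a n] ad by (metis add_diff_cancel_left' le_add1)
  then have "(fact n :: real) = fact ?a * fact ?d * real (n choose ?a)"
    by (metis of_nat_fact of_nat_mult)
  also have "\<dots> \<le> fact ?a * fact ?d * 2 ^ n"
    using of_nat_mono[OF binomial_le_pow2[of n ?a], where 'a = real] by (intro mult_left_mono) simp_all
  finally have "fact n / (fact (Suc n) * 2 ^ n) \<le> fact ?a * fact ?d * 2 ^ n / (fact (Suc n) * (2 ^ n :: real))"
    by (intro divide_right_mono) simp_all
  moreover have "fact n / (fact (Suc n) * 2 ^ n) = 1 / (real (Suc n) * 2 ^ n)"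
    by (simp only: fact_Suc) (simp del: of_nat_Suc)
  ultimately show ?thesis
    by (simp add: magnus_coeff_def abs_mult power_abs del: fact_Suc of_nat_Suc)
qed

text \<open>The permutation is the rank function: it counts the letters not exceeding the given one.
  Any other candidate orders the positions in the same way, hence has the same counts.\<close>

lemma ex1_cell:
  assumes x: "x \<in> lists {0..<1}" "length x = k" "distinct x"
  shows "\<exists>!\<sigma>. \<sigma> permutes {1..k} \<and> x \<in> cell k \<sigma>"
proof
  define L where "L a = {j \<in> {1..k}. x ! (j - 1) \<le> x ! (a - 1)}" for a
  \<comment> \<open>Outside {1..k} the value is the argument itself, as \<open>permutes\<close>
    demands.\<close>
  define r where "r a = (if a \<in> {1..k} then card (L a) else a)" for a
  have fin: "finite (L a)" for a by (simp add: L_def)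
  have le: "r b \<le> r a" if "a \<in> {1..k}" "b \<in> {1..k}" "x ! (b - 1) \<le> x ! (a - 1)" for a b
  proof -
    have "L b \<subseteq> L a" using that by (auto simp: L_def)
    then show ?thesis using that fin by (simp add: r_def card_mono)
  qed
  have less: "r a < r b" if "a \<in> {1..k}" "b \<in> {1..k}" "x ! (a - 1) < x ! (b - 1)" for a b
  proof -
    have "L a \<subseteq> L b" "b \<in> L b" "b \<notin> L a" using that by (auto simp: L_def)
    then have "L a \<subset> L b" by blast
    then show ?thesis using that fin by (simp add: r_def psubset_card_mono)
  qed
  have ne: "x ! (a - 1) \<noteq> x ! (b - 1)" if "a \<in> {1..k}" "b \<in> {1..k}" "a \<noteq> b" for a b
    using that x by (auto simp: nth_eq_iff_index_eq)
  have "r permutes {1..k}"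
  proof (rule bij_imp_permutes)
    have inj: "inj_on r {1..k}"
      by (rule inj_onI) (metis ne less less_irrefl linorder_neqE)
    moreover have "r a \<in> {1..k}" if "a \<in> {1..k}" for a
    proof -
      have "L a \<subseteq> {1..k}" "a \<in> L a" using that by (auto simp: L_def)
      then have "card (L a) \<le> card {1..k}" "card (L a) \<noteq> 0"
        using fin[of a] by (auto intro!: card_mono simp del: card_atLeastAtMost)
      then show ?thesis using that by (simp add: r_def)
    qed
    ultimately show "bij_betw r {1..k} {1..k}"
      unfolding bij_betw_def by (intro conjI endo_inj_surj) blast+
  qed (simp only: r_def if_False)
  moreover have "x \<in> cell k r"
  proof -
    have "x ! (a - 1) < x ! (b - 1)" if "a \<in> {1..k}" "b \<in> {1..k}" "r a < r b" for a b
      using le[OF that(1,2)] that(3) by linarith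
    then show ?thesis using x by (simp add: cell_def del: in_lists_conv_set One_nat_def)
  qed
  ultimately show "r permutes {1..k} \<and> x \<in> cell k r" by blast
  fix \<sigma> assume \<sigma>: "\<sigma> permutes {1..k} \<and> x \<in> cell k \<sigma>"
  show "\<sigma> = r"
  proof
    fix a
    show "\<sigma> a = r a"
    proof (cases "a \<in> {1..k}")
      case True
      have sl: "x ! (i - 1) < x ! (j - 1)" if "i \<in> {1..k}" "j \<in> {1..k}" "\<sigma> i < \<sigma> j" for i j
        using \<sigma> that by (auto simp: cell_def)
      have "L a = {j \<in> {1..k}. \<sigma> j \<le> \<sigma> a}"
        unfolding L_def
      proof (intro Collect_cong conj_cong refl)
        fix j assume j: "j \<in> {1..k}"
        show "x ! (j - 1) \<le> x ! (a - 1) \<longleftrightarrow> \<sigma> j \<le> \<sigma> a"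
        proof
          assume "x ! (j - 1) \<le> x ! (a - 1)"
          then show "\<sigma> j \<le> \<sigma> a" using sl[OF True j] by linarith
        next
          assume "\<sigma> j \<le> \<sigma> a"
          then consider "\<sigma> j < \<sigma> a" | "j = a"
            using permutes_inj[of \<sigma>] \<sigma> by (auto simp: le_less inj_eq)
          then show "x ! (j - 1) \<le> x ! (a - 1)"
            using sl[OF j True] by cases auto
        qed
      qed
      \<comment> \<open>A permutation of {1..k} takes exactly \<open>\<sigma> a\<close> values up to
        \<open>\<sigma> a\<close>, so counting preimages recovers \<open>\<sigma> a\<close> as the
        rank.\<close>
      moreover have "\<sigma> ` {j \<in> {1..k}. \<sigma> j \<le> \<sigma> a} = {1..\<sigma> a}"
      proof
        show "\<sigma> ` {j \<in> {1..k}. \<sigma> j \<le> \<sigma> a} \<subseteq> {1..\<sigma> a}"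
        proof (rule image_subsetI)
          fix j assume "j \<in> {j \<in> {1..k}. \<sigma> j \<le> \<sigma> a}"
          then have "\<sigma> j \<le> \<sigma> a" "\<sigma> j \<in> {1..k}"
            using \<sigma> permutes_in_image[of \<sigma> "{1..k}" j] by blast+
          then show "\<sigma> j \<in> {1..\<sigma> a}" by simp
        qed
        show "{1..\<sigma> a} \<subseteq> \<sigma> ` {j \<in> {1..k}. \<sigma> j \<le> \<sigma> a}"
        proof
          fix i assume i: "i \<in> {1..\<sigma> a}"
          have "\<sigma> a \<in> {1..k}" using \<sigma> True permutes_in_image[of \<sigma> "{1..k}" a] by blast
          moreover have "\<sigma> ` {1..k} = {1..k}" using \<sigma> permutes_image by blast
          ultimately have "i \<in> \<sigma> ` {1..k}" using i by simp
          then show "i \<in> \<sigma> ` {j \<in> {1..k}. \<sigma> j \<le> \<sigma> a}" using i by auto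
        qed
      qed
      moreover have "inj_on \<sigma> {j \<in> {1..k}. \<sigma> j \<le> \<sigma> a}"
        using permutes_inj_on[of \<sigma>] \<sigma> by blast
      ultimately have "card (L a) = \<sigma> a" 
        using card_image[of \<sigma> "{j \<in> {1..k}. \<sigma> j \<le> \<sigma> a}"] by simp
      then show ?thesis using True by (simp add: r_def)
    next
      case False
      then show ?thesis using \<sigma> by (auto simp: r_def permutes_not_in)
    qed
  qed
qed

text \<open>A single cell contains the word, so the density equals one coefficient and nothing can
  cancel.\<close>

lemma norm_magnus_density_ge:
  assumes x: "x \<in> lists {0..<1}" "length x = Suc n" "distinct x"
  shows "1 / (real (Suc n) * 2 ^ n) \<le> norm (magnus_density (Suc n) x :: 'k::real_normed_field)"
proof -
  obtain \<sigma> where \<sigma>: "\<sigma> permutes {1..Suc n}" "x \<in> cell (Suc n) \<sigma>"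
    and uniq: "\<And>\<tau>. \<tau> permutes {1..Suc n} \<Longrightarrow> x \<in> cell (Suc n) \<tau> \<Longrightarrow> \<tau> = \<sigma>"
    using ex1_cell[OF assms] by (elim ex1E) blast
  have "magnus_density (Suc n) x = magnus_coeff (Suc n) \<sigma> *\<^sub>R (1 :: 'k)"
  proof -
    have "magnus_density (Suc n) x
        = (\<Sum>\<tau>\<in>{\<sigma>}. magnus_coeff (Suc n) \<tau> *\<^sub>R (indicator (cell (Suc n) \<tau>) x :: 'k))"
      unfolding magnus_density_def
    proof (rule sum.mono_neutral_right)
      show "\<forall>\<tau>\<in>{\<tau>. \<tau> permutes {1..Suc n}} - {\<sigma>}.
          magnus_coeff (Suc n) \<tau> *\<^sub>R (indicator (cell (Suc n) \<tau>) x :: 'k) = 0"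
      proof
        fix \<tau> assume "\<tau> \<in> {\<tau>. \<tau> permutes {1..Suc n}} - {\<sigma>}"
        then have "x \<notin> cell (Suc n) \<tau>" using uniq by blast
        then show "magnus_coeff (Suc n) \<tau> *\<^sub>R (indicator (cell (Suc n) \<tau>) x :: 'k) = 0" by simp
      qed
    qed (use \<sigma>(1) in \<open>simp_all add: finite_permutations\<close>)
    then show ?thesis using \<sigma> by simp
  qed
  then show ?thesis using abs_magnus_coeff_ge[OF \<sigma>(1)] by simp
qed

section \<open>Partitions, boxes and the neighbourhood of the diagonal\<close>

lemma interval_partitionD:
  assumes "P \<in> interval_partitions {0..<1}"
  shows "finite P" "disjoint P" "\<Union>P = {0..<1}"
    and "\<And>J. J \<in> P \<Longrightarrow> is_interval J" "\<And>J. J \<in> P \<Longrightarrow> J \<subseteq> {0..<1}" "\<And>J. J \<in> P \<Longrightarrow> J \<in> sets borel"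
proof -
  show f: "finite P" "disjoint P" "\<Union>P = {0..<1}" "\<And>J. J \<in> P \<Longrightarrow> is_interval J"
    using assms by (auto simp: interval_partitions_def partition_on_def)
  then show "\<And>J. J \<in> P \<Longrightarrow> J \<subseteq> {0..<1}" "\<And>J. J \<in> P \<Longrightarrow> J \<in> sets borel"
    by (auto intro: real_interval_borel_measurable)
qed

text \<open>The index set of the Riemann sums in \<open>simplex_integral\<close>. As the blocks of
  an interval partition are disjoint intervals, the existence of \<open>t\<close> says that the
  blocks increase weakly; repeated blocks are included.\<close>

definition admissible :: "nat \<Rightarrow> real set set \<Rightarrow> (nat \<Rightarrow> real set) set" where
  "admissible k P = {s. s \<in> {1..k} \<rightarrow>\<^sub>E P \<and> (\<exists>t \<in> PiE {1..k} s. mono_on {1..k} t)}"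

text \<open>The support of the product of the \<open>Z1 (s (\<sigma> i))\<close>.\<close>

definition word_box :: "nat \<Rightarrow> (nat \<Rightarrow> nat) \<Rightarrow> (nat \<Rightarrow> real set) \<Rightarrow> real list set" where
  "word_box k \<sigma> s = listset (map (\<lambda>i. s (\<sigma> i)) [1..<k + 1])"

lemma mem_word_box_iff: "x \<in> word_box k \<sigma> s \<longleftrightarrow> length x = k \<and> (\<forall>a\<in>{1..k}. x ! (a - 1) \<in> s (\<sigma> a))"
proof -
  have "x \<in> word_box k \<sigma> s \<longleftrightarrow> length x = k \<and> (\<forall>i<k. x ! i \<in> s (\<sigma> (Suc i)))"
    by (auto simp: word_box_def mem_listset_iff list_all2_conv_all_nth simp del: upt_Suc)
  moreover have "(\<forall>i<k. x ! i \<in> s (\<sigma> (Suc i))) \<longleftrightarrow> (\<forall>a\<in>{1..k}. x ! (a - 1) \<in> s (\<sigma> a))"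
  proof
    assume *: "\<forall>i<k. x ! i \<in> s (\<sigma> (Suc i))"
    show "\<forall>a\<in>{1..k}. x ! (a - 1) \<in> s (\<sigma> a)"
    proof
      fix a assume "a \<in> {1..k}"
      then have "a - 1 < k" "Suc (a - 1) = a" by auto
      with * show "x ! (a - 1) \<in> s (\<sigma> a)" by metis
    qed
  next
    assume *: "\<forall>a\<in>{1..k}. x ! (a - 1) \<in> s (\<sigma> a)"
    show "\<forall>i<k. x ! i \<in> s (\<sigma> (Suc i))"
    proof (intro allI impI)
      fix i assume "i < k"
      then show "x ! i \<in> s (\<sigma> (Suc i))" using *[rule_format, of "Suc i"] by simp
    qed
  qed
  ultimately show ?thesis by blast
qed

text \<open>An integrable majorant of the indicator of the words with two letters in a common block of \<open>P\<close>.\<close>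

definition collisions :: "nat \<Rightarrow> real set set \<Rightarrow> real list \<Rightarrow> real" where
  "collisions k P x = (\<Sum>i<k. \<Sum>j\<in>{..<k} - {i}. \<Sum>J\<in>P.
     indicator (listset ((replicate k {0..<1})[i := J, j := J])) x)"

lemma collisions_nonneg: "collisions k P x \<ge> 0"
  by (simp add: collisions_def sum_nonneg)

lemma collisions_ge_1:
  assumes "finite P" "x \<in> lists {0..<1}" "length x = k"
    and ij: "i < k" "j < k" "i \<noteq> j" "J \<in> P" "x ! i \<in> J" "x ! j \<in> J"
  shows "1 \<le> collisions k P x"
proof -
  let ?f = "\<lambda>i j J. indicator (listset ((replicate k {0..<1})[i := J, j := J])) x :: real"
  have "x \<in> listset ((replicate k {0..<1})[i := J, j := J])"
    using assms by (auto simp: mem_listset_iff list_all2_conv_all_nth nth_list_update)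
  then have "1 = ?f i j J" by simp
  also have "\<dots> \<le> (\<Sum>J\<in>P. ?f i j J)"
    using assms by (intro member_le_sum) auto
  also have "\<dots> \<le> (\<Sum>j\<in>{..<k} - {i}. \<Sum>J\<in>P. ?f i j J)"
    using ij by (intro member_le_sum[of j "{..<k} - {i}" "\<lambda>j. \<Sum>J\<in>P. ?f i j J"]) (auto intro: sum_nonneg)
  also have "\<dots> \<le> collisions k P x"
    unfolding collisions_def
    using ij by (intro member_le_sum[of i "{..<k}" "\<lambda>i. \<Sum>j\<in>{..<k} - {i}. \<Sum>J\<in>P. ?f i j J"]) (auto intro: sum_nonneg)
  finally show ?thesis .
qed

text \<open>For a pair of positions, the boxes have volume at most |J|^2 <= \<delta> |J|, and the
  lengths |J| sum to at most 1. There are at most \<open>k * k\<close> ordered pairs.\<close>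

lemma
  assumes P: "P \<in> interval_partitions {0..<1}"
  shows integrable_collisions: "integrable words (collisions k P)"
    and integral_collisions_le:
      "\<lbrakk>\<And>J. J \<in> P \<Longrightarrow> measure lborel J \<le> \<delta>; \<delta> \<ge> 0\<rbrakk> \<Longrightarrow> (\<integral>x. collisions k P x \<partial>words) \<le> real (k * k) * \<delta>"
proof -
  let ?L = "\<lambda>i j J. (replicate k {0..<1::real})[i := J, j := J]"
  have L: "A \<in> sets borel \<and> A \<subseteq> {0..<1}" if "J \<in> P" "A \<in> set (?L i j J)" for A J i j
  proof -
    have "A \<in> insert J (insert J (set (replicate k {0..<1})))"
      using that set_update_subset_insert[of "(replicate k {0..<1})[i := J]" j J]
        set_update_subset_insert[of "replicate k {0..<1::real}" i J] by blast
    then show ?thesis using interval_partitionD(5,6)[OF P that(1)] by auto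
  qed
  note int = integrable_indicator_listset[OF L]
  show "integrable words (collisions k P)"
    unfolding collisions_def[abs_def] by (intro Bochner_Integration.integrable_sum int)
  assume \<delta>: "\<And>J. J \<in> P \<Longrightarrow> measure lborel J \<le> \<delta>" "\<delta> \<ge> 0"
  have le: "(\<integral>x. indicator (listset (?L i j J)) x \<partial>words) \<le> \<delta> * measure lborel J"
    if "i < k" "j \<in> {..<k} - {i}" "J \<in> P" for i j J
  proof -
    have "(\<integral>x. indicator (listset (?L i j J)) x \<partial>words) \<le> prod_list (map (measure lborel) (?L i j J))"
      using L[OF that(3)] by (rule integral_indicator_listset_le)
    also have "\<dots> = (\<Prod>l<k. if l = i \<or> l = j then measure lborel J else 1)"
      using that by (auto simp: prod.list_conv_set_nth atLeast0LessThan nth_list_update intro!: prod.cong)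
    also have "\<dots> = (\<Prod>l\<in>{i, j}. if l = i \<or> l = j then measure lborel J else 1)"
      using that by (intro prod.mono_neutral_right) auto
    also have "\<dots> = measure lborel J * measure lborel J"
      using that by simp
    also have "\<dots> \<le> \<delta> * measure lborel J"
      using \<delta>(1)[OF that(3)] by (intro mult_right_mono) auto
    finally show ?thesis .
  qed
  have "(\<integral>x. collisions k P x \<partial>words)
      = (\<Sum>i<k. \<Sum>j\<in>{..<k} - {i}. \<Sum>J\<in>P. \<integral>x. indicator (listset (?L i j J)) x \<partial>words)"
    unfolding collisions_def
    by (simp add: Bochner_Integration.integral_sum Bochner_Integration.integrable_sum int)
  also have "\<dots> \<le> (\<Sum>i<k. \<Sum>j\<in>{..<k} - {i}. \<Sum>J\<in>P. \<delta> * measure lborel J)"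
    using le by (intro sum_mono) auto
  also have "\<dots> \<le> (\<Sum>i<k. \<Sum>j\<in>{..<k} - {i}. \<delta>)"
  proof (intro sum_mono)
    have "(\<Sum>J\<in>P. measure lborel J) \<le> 1"
      using interval_partitionD[OF P] by (intro sum_measure_intervals_le) auto
    then show "(\<Sum>J\<in>P. \<delta> * measure lborel J) \<le> \<delta>"
      using \<delta>(2) by (simp add: sum_distrib_left[symmetric] mult_left_le)
  qed
  also have "\<dots> \<le> (\<Sum>i<k. \<Sum>j<k. \<delta>)"
    using \<delta>(2) by (intro sum_mono sum_mono2) auto
  finally show "(\<integral>x. collisions k P x \<partial>words) \<le> real (k * k) * \<delta>" by simp
qed

section \<open>Riemann sums against the density\<close>

text \<open>If \<open>b\<close> were at most \<open>a\<close>, then either \<open>b\<close> lies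
  between \<open>u\<close> and \<open>a\<close>, or \<open>u\<close> lies between \<open>b\<close>
  and \<open>v\<close>; both give a common point. This lifts the order of two sample points to the
  order of whole blocks.\<close>

lemma is_interval_disjnt_less:
  fixes A B :: "real set"
  assumes "is_interval A" "is_interval B" "A \<inter> B = {}" "u \<in> A" "v \<in> B" "u \<le> v" "a \<in> A" "b \<in> B"
  shows "a < b"
proof (rule ccontr)
  assume "\<not> a < b"
  then have "b \<le> a" by simp
  show False
  proof (cases "u \<le> b")
    case True
    then have "b \<in> A" using assms \<open>b \<le> a\<close> by (meson is_interval_1)
    with assms show False by blast
  next
    case False
    then have "u \<in> B" using assms by (meson is_interval_1 le_cases)
    with assms show False by blast
  qed
qed

text \<open>Disjointness of the blocks makes the sum 0 or 1, like the indicator of the cell. The two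
  can differ only if two letters share a block, and there the majorant is at least 1.\<close>

lemma sum_admissible_word_box:
  assumes P: "P \<in> interval_partitions {0..<1}" and \<sigma>: "\<sigma> permutes {1..k}" and x: "x \<in> lists {0..<1}"
  shows "norm ((\<Sum>s\<in>admissible k P. indicator (word_box k \<sigma> s) x) - indicator (cell k \<sigma>) x :: 'k::real_normed_field)
    \<le> collisions k P x"
proof -
  note PD = interval_partitionD[OF P]
  have fin: "finite (admissible k P)"
    by (rule finite_subset[of _ "{1..k} \<rightarrow>\<^sub>E P"]) (auto simp: admissible_def intro: finite_PiE PD)
  have eqJ: "A = B" if "A \<in> P" "B \<in> P" "z \<in> A" "z \<in> B" for A B z
    using PD(2) that by (auto simp: pairwise_def disjnt_def)
  \<comment> \<open>The letter at position \<open>a\<close> determines the block with index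
    \<open>\<sigma> a\<close>, and these indices exhaust {1..k}.\<close>
  have uniq: "s = s'" if s: "s \<in> admissible k P" "s' \<in> admissible k P" "x \<in> word_box k \<sigma> s" "x \<in> word_box k \<sigma> s'" for s s'
  proof (rule PiE_ext)
    show S: "s \<in> {1..k} \<rightarrow>\<^sub>E P" "s' \<in> {1..k} \<rightarrow>\<^sub>E P" using s by (auto simp: admissible_def)
    fix i assume i: "i \<in> {1..k}"
    then obtain a where a: "a \<in> {1..k}" "\<sigma> a = i" using permutes_image[OF \<sigma>] by (metis imageE)
    show "s i = s' i"
      using S i s(3,4) a by (intro eqJ[of _ _ "x ! (a - 1)"]) (auto simp: mem_word_box_iff)
  qed
  define b :: bool where "b \<longleftrightarrow> (\<exists>s\<in>admissible k P. x \<in> word_box k \<sigma> s)"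
  have sum: "(\<Sum>s\<in>admissible k P. indicator (word_box k \<sigma> s) x) = (of_bool b :: 'k)"
  proof (cases b)
    case True
    then obtain s where s: "s \<in> admissible k P" "x \<in> word_box k \<sigma> s" by (auto simp: b_def)
    have "(\<Sum>s'\<in>admissible k P. indicator (word_box k \<sigma> s') x) = (\<Sum>s'\<in>admissible k P. if s' = s then 1 else 0 :: 'k)"
    proof (intro sum.cong refl)
      fix s' assume s': "s' \<in> admissible k P"
      have "x \<in> word_box k \<sigma> s' \<longleftrightarrow> s' = s" using uniq[OF s' s(1) _ s(2)] s(2) by blast
      then show "indicator (word_box k \<sigma> s') x = (if s' = s then 1 else 0 :: 'k)" by (simp add: indicator_def)
    qed
    then show ?thesis using s(1) fin True by simp
  next
    case False
    then show ?thesis by (auto simp: b_def indicator_def)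
  qed
  show ?thesis
  proof (cases "b \<longleftrightarrow> x \<in> cell k \<sigma>")
    case True
    then show ?thesis unfolding sum by (simp add: indicator_def collisions_nonneg)
  next
    case False
    \<comment> \<open>Since the two truth values differ, the word lies in a box or in the cell, and
      either fixes its length.\<close>
    have "length x = k" using False by (auto simp: b_def mem_word_box_iff cell_def)
    have "\<exists>i<k. \<exists>j<k. i \<noteq> j \<and> (\<exists>J\<in>P. x ! i \<in> J \<and> x ! j \<in> J)"
    proof (rule ccontr)
      assume no: "\<not> (\<exists>i<k. \<exists>j<k. i \<noteq> j \<and> (\<exists>J\<in>P. x ! i \<in> J \<and> x ! j \<in> J))"
      have ne: "a = c" if "a \<in> {1..k}" "c \<in> {1..k}" "J \<in> P" "x ! (a - 1) \<in> J" "x ! (c - 1) \<in> J" for a c J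
      proof -
        have "a - 1 < k" "c - 1 < k" using that by auto
        then have "a - 1 = c - 1" using no that by blast
        then show "a = c" using that by auto
      qed
      show False
      proof (cases b)
        case True
        then obtain s t where s: "s \<in> {1..k} \<rightarrow>\<^sub>E P" "x \<in> word_box k \<sigma> s"
          and t: "t \<in> PiE {1..k} s" "mono_on {1..k} t" by (auto simp: b_def admissible_def)
        \<comment> \<open>Without collisions the two blocks differ, so they are disjoint, and the
          monotone sample \<open>t\<close> decides which of them is on the left.\<close>
        have "x ! (a - 1) < x ! (c - 1)" if ac: "a \<in> {1..k}" "c \<in> {1..k}" "\<sigma> a < \<sigma> c" for a c
        proof -
          have \<sigma>ac: "\<sigma> a \<in> {1..k}" "\<sigma> c \<in> {1..k}" using ac permutes_in_image[OF \<sigma>] by blast+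
          have sP: "s (\<sigma> a) \<in> P" "s (\<sigma> c) \<in> P" using \<sigma>ac s by blast+
          have xs: "x ! (a - 1) \<in> s (\<sigma> a)" "x ! (c - 1) \<in> s (\<sigma> c)" using ac s by (auto simp: mem_word_box_iff)
          have "s (\<sigma> a) \<noteq> s (\<sigma> c)"
            using ne[OF ac(1,2) sP(1) xs(1)] xs(2) ac(3) by auto
          then have "s (\<sigma> a) \<inter> s (\<sigma> c) = {}" using eqJ[OF sP] by blast
          moreover have "t (\<sigma> a) \<le> t (\<sigma> c)" using t(2) \<sigma>ac ac(3) by (simp add: mono_on_def)
          moreover have "t (\<sigma> a) \<in> s (\<sigma> a)" "t (\<sigma> c) \<in> s (\<sigma> c)" using t(1) \<sigma>ac by blast+
          ultimately show ?thesis
            using is_interval_disjnt_less[OF PD(4)[OF sP(1)] PD(4)[OF sP(2)]] xs by blast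
        qed
        then have "x \<in> cell k \<sigma>" using x \<open>length x = k\<close> unfolding cell_def by blast
        with False True show False by blast
      next
        case nb: False
        with False have c: "x \<in> cell k \<sigma>" by blast
        have "\<exists>J\<in>P. x ! (a - 1) \<in> J" if "a \<in> {1..k}" for a
        proof -
          have "x ! (a - 1) \<in> set x" using that \<open>length x = k\<close> by (intro nth_mem) auto
          then have "x ! (a - 1) \<in> {0..<1}" using x by blast
          then show ?thesis using PD(3) by blast
        qed
        then obtain B where B: "\<And>a. a \<in> {1..k} \<Longrightarrow> B a \<in> P \<and> x ! (a - 1) \<in> B a" by metis
        let ?\<tau> = "inv \<sigma>"
        have \<tau>: "?\<tau> i \<in> {1..k}" if "i \<in> {1..k}" for i
          using that permutes_in_image[OF permutes_inv[OF \<sigma>]] by blast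
        have \<sigma>\<tau>: "\<sigma> (?\<tau> i) = i" "?\<tau> (\<sigma> i) = i" for i using permutes_inverses[OF \<sigma>] by blast+
        \<comment> \<open>The letter of rank \<open>i\<close> stands at position
          \<open>inv \<sigma> i\<close>. Its block serves as the \<open>i\<close>-th block, and the
          sorted word itself is the monotone sample.\<close>
        define s where "s = (\<lambda>i\<in>{1..k}. B (?\<tau> i))"
        define t where "t = (\<lambda>i\<in>{1..k}. x ! (?\<tau> i - 1))"
        have "s \<in> {1..k} \<rightarrow>\<^sub>E P" using B \<tau> by (auto simp: s_def simp del: One_nat_def)
        moreover have "t \<in> PiE {1..k} s" using B \<tau> by (auto simp: s_def t_def simp del: One_nat_def)
        moreover have "mono_on {1..k} t"
        proof (rule mono_onI)
          fix i j assume ij: "i \<in> {1..k}" "j \<in> {1..k}" "i \<le> j"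
          show "t i \<le> t j"
          proof (cases "i = j")
            case neq: False
            then have "\<sigma> (?\<tau> i) < \<sigma> (?\<tau> j)" using ij \<sigma>\<tau> by simp
            then have "x ! (?\<tau> i - 1) < x ! (?\<tau> j - 1)" using c \<tau>[OF ij(1)] \<tau>[OF ij(2)] unfolding cell_def by blast
            then show ?thesis using ij by (simp add: t_def)
          qed simp
        qed
        ultimately have "s \<in> admissible k P" unfolding admissible_def by blast
        moreover have "x \<in> word_box k \<sigma> s"
          unfolding mem_word_box_iff
        proof (intro conjI ballI)
          fix a assume a: "a \<in> {1..k}"
          then have "\<sigma> a \<in> {1..k}" using permutes_in_image[OF \<sigma>] by blast
          then show "x ! (a - 1) \<in> s (\<sigma> a)" using B[OF a] \<sigma>\<tau> by (simp add: s_def)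
        qed fact
        ultimately show False using nb unfolding b_def by blast
      qed
    qed
    then have "1 \<le> collisions k P x"
      using collisions_ge_1[OF PD(1) x \<open>length x = k\<close>] by blast
    then show ?thesis unfolding sum using False by (auto simp: indicator_def)
  qed
qed

text \<open>Integrates the pointwise comparison, weighted by the coefficients. The bound depends on
  the partition only through \<open>\<delta>\<close>.\<close>

lemma norm_riemann_sum_diff_le:
  fixes c :: real
  assumes P: "P \<in> interval_partitions {0..<1}"
    and \<delta>: "\<And>J. J \<in> P \<Longrightarrow> measure lborel J \<le> \<delta>" "\<delta> \<ge> 0"
  shows "norm ((\<Sum>s\<in>admissible k P. magnus_commutator k (\<lambda>i. c *\<^sub>R Z1 (s i)))
      - c ^ k *\<^sub>R (abs_F1 (magnus_density k) :: 'k::{real_normed_field,banach,second_countable_topology} F1))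
    \<le> \<bar>c\<bar> ^ k * (\<Sum>\<sigma> | \<sigma> permutes {1..k}. \<bar>magnus_coeff k \<sigma>\<bar>) * (real (k * k) * \<delta>)"
proof -
  note PD = interval_partitionD[OF P]
  let ?\<Sigma> = "{\<sigma>. \<sigma> permutes {1..k}}"
  let ?C = "\<Sum>\<sigma>\<in>?\<Sigma>. \<bar>magnus_coeff k \<sigma>\<bar>"
  let ?f = "\<lambda>s x. c ^ k *\<^sub>R (\<Sum>\<sigma>\<in>?\<Sigma>. magnus_coeff k \<sigma> *\<^sub>R (indicator (word_box k \<sigma> s) x :: 'k))"
  let ?g = "\<lambda>x. c ^ k *\<^sub>R (magnus_density k x :: 'k)"
  have fin: "finite (admissible k P)"
    by (rule finite_subset[of _ "{1..k} \<rightarrow>\<^sub>E P"]) (auto simp: admissible_def intro: finite_PiE PD)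
  have s: "s i \<in> sets borel \<and> s i \<subseteq> {0..<1}" if "s \<in> admissible k P" "i \<in> {1..k}" for s i
  proof -
    have "s i \<in> P" using that unfolding admissible_def by blast
    then show ?thesis using PD(5,6) by blast
  qed
  have int: "integrable words (?f s)" if "s \<in> admissible k P" for s
  proof (intro integrable_scaleR_right Bochner_Integration.integrable_sum)
    fix \<sigma> assume \<sigma>: "\<sigma> \<in> ?\<Sigma>"
    show "integrable words (\<lambda>x. indicator (word_box k \<sigma> s) x :: 'k)"
      unfolding word_box_def
    proof (rule integrable_indicator_listset)
      fix A assume "A \<in> set (map (\<lambda>i. s (\<sigma> i)) [1..<k + 1])"
      then have "A \<in> (\<lambda>i. s (\<sigma> i)) ` {1..k}" by (auto simp: image_iff Bex_def)
      moreover have "\<sigma> i \<in> {1..k}" if "i \<in> {1..k}" for i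
        using \<sigma> that permutes_in_image[of \<sigma> "{1..k}" i] by blast
      ultimately show "A \<in> sets borel \<and> A \<subseteq> {0..<1}" using s[OF that] by blast
    qed
  qed
  have intg: "integrable words ?g"
    by (intro integrable_scaleR_right integrable_magnus_density)
  have ints: "integrable words (\<lambda>x. \<Sum>s\<in>admissible k P. ?f s x)"
    by (intro Bochner_Integration.integrable_sum int)
  have "(\<Sum>s\<in>admissible k P. magnus_commutator k (\<lambda>i. c *\<^sub>R Z1 (s i))) = (\<Sum>s\<in>admissible k P. abs_F1 (?f s))"
    unfolding word_box_def using s by (intro sum.cong refl magnus_commutator_Z1) blast
  also have "\<dots> = abs_F1 (\<lambda>x. \<Sum>s\<in>admissible k P. ?f s x)"
    by (intro abs_F1_sum fin int)
  finally have "norm ((\<Sum>s\<in>admissible k P. magnus_commutator k (\<lambda>i. c *\<^sub>R Z1 (s i)))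
      - c ^ k *\<^sub>R (abs_F1 (magnus_density k) :: 'k F1))
    = norm (abs_F1 (\<lambda>x. (\<Sum>s\<in>admissible k P. ?f s x) - ?g x))"
    by (simp only: abs_F1_scaleR[OF integrable_magnus_density] abs_F1_diff[OF ints intg])
  also have "\<dots> = (\<integral>x. norm ((\<Sum>s\<in>admissible k P. ?f s x) - ?g x) \<partial>words)"
    by (intro norm_abs_F1 Bochner_Integration.integrable_diff ints intg)
  also have "\<dots> \<le> (\<integral>x. \<bar>c\<bar> ^ k * ?C * collisions k P x \<partial>words)"
  proof (rule integral_mono)
    show "integrable words (\<lambda>x. norm ((\<Sum>s\<in>admissible k P. ?f s x) - ?g x))"
      by (intro integrable_norm Bochner_Integration.integrable_diff ints intg)
    show "integrable words (\<lambda>x. \<bar>c\<bar> ^ k * ?C * collisions k P x)"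
      by (intro integrable_mult_right integrable_collisions[OF P])
    fix x assume x: "x \<in> space words"
    \<comment> \<open>Exchanging the sums over boxes and permutations isolates, for each
      \<open>\<sigma>\<close>, the difference bounded by the collisions.\<close>
    have "(\<Sum>s\<in>admissible k P. ?f s x) - ?g x = c ^ k *\<^sub>R (\<Sum>\<sigma>\<in>?\<Sigma>. magnus_coeff k \<sigma> *\<^sub>R
        ((\<Sum>s\<in>admissible k P. indicator (word_box k \<sigma> s) x) - indicator (cell k \<sigma>) x))"
      unfolding magnus_density_def scaleR_sum_right[symmetric] scaleR_diff_right sum_subtractf
      by (subst sum.swap) (simp only: scaleR_sum_right)
    also have "norm \<dots> \<le> \<bar>c\<bar> ^ k * (\<Sum>\<sigma>\<in>?\<Sigma>. \<bar>magnus_coeff k \<sigma>\<bar> * collisions k P x)"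
    proof -
      have "norm (\<Sum>\<sigma>\<in>?\<Sigma>. magnus_coeff k \<sigma> *\<^sub>R
          ((\<Sum>s\<in>admissible k P. indicator (word_box k \<sigma> s) x) - indicator (cell k \<sigma>) x :: 'k))
        \<le> (\<Sum>\<sigma>\<in>?\<Sigma>. \<bar>magnus_coeff k \<sigma>\<bar> * collisions k P x)"
      proof (rule sum_norm_le)
        fix \<sigma> assume "\<sigma> \<in> ?\<Sigma>"
        then have "norm ((\<Sum>s\<in>admissible k P. indicator (word_box k \<sigma> s) x) - indicator (cell k \<sigma>) x :: 'k)
            \<le> collisions k P x"
          using x by (intro sum_admissible_word_box[OF P]) (simp_all only: space_words mem_Collect_eq)
        then show "norm (magnus_coeff k \<sigma> *\<^sub>R
          ((\<Sum>s\<in>admissible k P. indicator (word_box k \<sigma> s) x) - indicator (cell k \<sigma>) x :: 'k))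
          \<le> \<bar>magnus_coeff k \<sigma>\<bar> * collisions k P x"
          unfolding norm_scaleR by (rule mult_left_mono) simp
      qed
      then show ?thesis
        unfolding norm_scaleR power_abs by (rule mult_left_mono) simp
    qed
    also have "\<dots> = \<bar>c\<bar> ^ k * ?C * collisions k P x"
      by (simp only: sum_distrib_right mult.assoc)
    finally show "norm ((\<Sum>s\<in>admissible k P. ?f s x) - ?g x) \<le> \<bar>c\<bar> ^ k * ?C * collisions k P x" .
  qed
  also have "\<dots> = \<bar>c\<bar> ^ k * ?C * (\<integral>x. collisions k P x \<partial>words)"
    by (rule Bochner_Integration.integral_mult_right) (intro integrable_collisions[OF P])
  also have "\<dots> \<le> \<bar>c\<bar> ^ k * ?C * (real (k * k) * \<delta>)"
    by (intro mult_left_mono integral_collisions_le[OF P \<delta>] mult_nonneg_nonneg sum_nonneg) simp_all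
  finally show ?thesis .
qed

section \<open>The limit of the Riemann sums\<close>

lemma ex_fine_partition:
  assumes "\<delta> > 0"
  shows "\<exists>P\<in>interval_partitions {0..<1}. \<forall>J\<in>P. measure lborel J \<le> \<delta>"
proof -
  obtain n :: nat where n: "1 / \<delta> < real n" using reals_Archimedean2 by blast
  with assms have n0: "real n > 0" by (meson divide_pos_pos less_trans zero_less_one)
  define B where "B i = {real i / n ..< (real i + 1) / n}" for i :: nat
  \<comment> \<open>Reading membership off the floor turns covering and disjointness into facts
    about integers.\<close>
  have B: "x \<in> B i \<longleftrightarrow> \<lfloor>real n * x\<rfloor> = int i" for x i
    using n0 by (auto simp: B_def floor_eq_iff field_simps)
  have "B ` {..<n} \<in> interval_partitions {0..<1}"
    unfolding interval_partitions_def partition_on_def mem_Collect_eq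
  proof (intro conjI)
    show "\<Union> (B ` {..<n}) = {0..<1}"
    proof (intro subset_antisym subsetI)
      fix x assume "x \<in> \<Union> (B ` {..<n})"
      then obtain i where i: "i < n" "x \<in> B i" by blast
      then have "0 \<le> real i / n" "(real i + 1) / n \<le> 1" using n0 by auto
      moreover have "real i / n \<le> x" "x < (real i + 1) / n" using i(2) by (simp_all add: B_def)
      ultimately show "x \<in> {0..<1}" by (simp only: atLeastLessThan_iff) linarith
    next
      fix x :: real assume x: "x \<in> {0..<1}"
      have "0 \<le> real n * x" "real n * x < real n" using x n0 by auto
      then have "0 \<le> \<lfloor>real n * x\<rfloor>" "\<lfloor>real n * x\<rfloor> < int n" by (auto simp: floor_less_iff)
      then have "x \<in> B (nat \<lfloor>real n * x\<rfloor>)" "nat \<lfloor>real n * x\<rfloor> < n"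
        by (simp_all add: B nat_less_iff)
      then show "x \<in> \<Union> (B ` {..<n})" by blast
    qed
    show "disjoint (B ` {..<n})"
      unfolding pairwise_def disjnt_def
    proof (intro ballI impI)
      fix A A' assume "A \<in> B ` {..<n}" "A' \<in> B ` {..<n}" "A \<noteq> A'"
      then obtain i j where "A = B i" "A' = B j" "i \<noteq> j" by blast
      then show "A \<inter> A' = {}" by (auto simp: B)
    qed
    have "real i / n \<in> B i" for i using n0 by (simp add: B_def divide_strict_right_mono)
    then show "{} \<notin> B ` {..<n}" by force
    show "\<forall>J\<in>B ` {..<n}. is_interval J" by (auto simp: B_def is_interval_1)
  qed simp
  moreover have "measure lborel (B i) \<le> \<delta>" for i
  proof -
    have "measure lborel (B i) = 1 / n"
      using n0 by (simp add: B_def field_simps)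
    also have "\<dots> \<le> \<delta>" using n n0 assms by (simp add: field_simps)
    finally show ?thesis .
  qed
  ultimately show ?thesis by blast
qed

text \<open>Block lengths do not grow under refinement, so one sufficiently fine partition controls
  all of its refinements, which is convergence along \<open>refining\<close>.\<close>

lemma magnus_term_Z1:
  fixes c :: real
  shows "magnus_term k {0..<1} (\<lambda>J. c *\<^sub>R Z1 J)
    = c ^ k *\<^sub>R (abs_F1 (magnus_density k) :: 'k::{real_normed_field,banach,second_countable_topology} F1)"
  unfolding magnus_term_def
proof (rule simplex_integral_eqI)
  show I: "is_interval {0..<1::real}" by (simp add: is_interval_1)
  let ?C = "\<bar>c\<bar> ^ k * (\<Sum>\<sigma> | \<sigma> permutes {1..k}. \<bar>magnus_coeff k \<sigma>\<bar>)"
  have C: "?C \<ge> 0" by (intro mult_nonneg_nonneg sum_nonneg) simp_all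
  show "((\<lambda>P. \<Sum>s | s \<in> {1..k} \<rightarrow>\<^sub>E P \<and> (\<exists>t \<in> PiE {1..k} s. mono_on {1..k} t).
      magnus_commutator k (\<lambda>i. c *\<^sub>R Z1 (s i))) \<longlongrightarrow> c ^ k *\<^sub>R (abs_F1 (magnus_density k) :: 'k F1)) (refining {0..<1})"
    unfolding admissible_def[symmetric]
  proof (rule tendstoI)
    fix e :: real assume e: "e > 0"
    \<comment> \<open>The \<open>+ 1\<close> keeps the denominator positive when the error constant
      vanishes (\<open>k = 0\<close> or \<open>c = 0\<close>), and it makes the final bound
      strict.\<close>
    define \<delta> where "\<delta> = e / (?C * real (k * k) + 1)"
    have pos: "?C * real (k * k) + 1 > 0" using C by (intro add_nonneg_pos mult_nonneg_nonneg) simp_all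
    then have \<delta>: "\<delta> > 0" using e by (simp only: \<delta>_def divide_pos_pos)
    have "?C * (real (k * k) * \<delta>) < (?C * real (k * k) + 1) * \<delta>" using \<delta> by (simp only: distrib_right mult.assoc)
    also have "\<dots> = e" using pos by (simp only: \<delta>_def) simp
    finally have less: "?C * (real (k * k) * \<delta>) < e" .
    obtain P where P: "P \<in> interval_partitions {0..<1}" "\<And>J. J \<in> P \<Longrightarrow> measure lborel J \<le> \<delta>"
      using ex_fine_partition[OF \<delta>] by blast
    show "\<forall>\<^sub>F Q in refining {0..<1}. dist (\<Sum>s\<in>admissible k Q. magnus_commutator k (\<lambda>i. c *\<^sub>R Z1 (s i)))
        (c ^ k *\<^sub>R (abs_F1 (magnus_density k) :: 'k F1)) < e"
      unfolding eventually_refining[OF I]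
    proof (intro bexI[OF _ P(1)] ballI impI)
      fix Q assume Q: "Q \<in> interval_partitions {0..<1}" "refines {0..<1} Q P"
      have "measure lborel J \<le> \<delta>" if J: "J \<in> Q" for J
      proof -
        obtain K where K: "K \<in> P" "J \<subseteq> K" using Q(2) J unfolding refines_def by blast
        have "emeasure lborel K \<le> emeasure lborel {0..<1::real}"
          using interval_partitionD(5)[OF P(1) K(1)] by (intro emeasure_mono) auto
        then have "K \<in> fmeasurable lborel"
          using interval_partitionD(6)[OF P(1) K(1)] by (auto simp: fmeasurable_def le_less_trans)
        then have "measure lborel J \<le> measure lborel K"
          using K(2) interval_partitionD(6)[OF Q(1) J] by (intro measure_mono_fmeasurable) simp_all
        then show ?thesis using P(2)[OF K(1)] by linarith
      qed
      from norm_riemann_sum_diff_le[OF Q(1) this less_imp_le[OF \<delta>], of k c, where 'k = 'k] less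
      show "dist (\<Sum>s\<in>admissible k Q. magnus_commutator k (\<lambda>i. c *\<^sub>R Z1 (s i)))
        (c ^ k *\<^sub>R (abs_F1 (magnus_density k) :: 'k F1)) < e"
        unfolding dist_norm by (rule le_less_trans)
    qed
  qed
qed

section \<open>Norms of the terms and divergence\<close>

text \<open>Instead of showing that almost every word has distinct letters, the proof uses the
  minorant \<epsilon> times \<open>indicator ?W - collisions\<close>. It is at most \<epsilon>
  everywhere and at most 0 off the words of length \<open>Suc n\<close> with distinct letters, and
  its integral comes arbitrarily close to \<epsilon>.\<close>

lemma norm_abs_F1_magnus_density_ge:
  "1 / (real (Suc n) * 2 ^ n)
    \<le> norm (abs_F1 (magnus_density (Suc n)) :: 'k::{real_normed_field,banach,second_countable_topology} F1)"
proof (rule field_le_epsilon)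
  let ?N = "norm (abs_F1 (magnus_density (Suc n)) :: 'k F1)" and ?W = "{x \<in> lists {0..<1}. length x = Suc n}"
  define \<epsilon> where "\<epsilon> = 1 / (real (Suc n) * 2 ^ n)"
  have \<epsilon>: "\<epsilon> > 0" by (simp add: \<epsilon>_def)
  fix e :: real assume e: "e > 0"
  \<comment> \<open>Chosen so that \<epsilon> times the bound on the integral of the collisions is
    exactly \<open>e\<close>.\<close>
  define \<delta> where "\<delta> = e / (\<epsilon> * real (Suc n * Suc n))"
  have \<delta>: "\<delta> > 0" using e \<epsilon> unfolding \<delta>_def by (intro divide_pos_pos mult_pos_pos) (simp_all only: of_nat_0_less_iff zero_less_Suc nat_0_less_mult_iff simp_thms)
  obtain P where P: "P \<in> interval_partitions {0..<1}" "\<And>J. J \<in> P \<Longrightarrow> measure lborel J \<le> \<delta>"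
    using ex_fine_partition[OF \<delta>] by blast
  note intc = integrable_collisions[OF P(1), of "Suc n"]
  have intW: "integrable words (indicator ?W :: real list \<Rightarrow> real)"
    by (intro integrable_indicator_words sets_words_length) (simp add: emeasure_words_length)
  have W: "(\<integral>x. indicator ?W x \<partial>words) = (1 :: real)"
    using integral_norm_indicator_words[where 'k = real, OF sets_words_length[of "Suc n"]]
    by (simp add: emeasure_words_length measure_def)
  have "\<epsilon> - e \<le> \<epsilon> * (1 - (\<integral>x. collisions (Suc n) P x \<partial>words))"
  proof -
    have "\<epsilon> * (\<integral>x. collisions (Suc n) P x \<partial>words) \<le> \<epsilon> * (real (Suc n * Suc n) * \<delta>)"
      using \<epsilon> integral_collisions_le[OF P less_imp_le[OF \<delta>], of "Suc n"] by (intro mult_left_mono) simp_all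
    also have "\<dots> = e" using \<epsilon> unfolding \<delta>_def by (simp del: of_nat_Suc of_nat_mult)
    finally show ?thesis by (simp add: right_diff_distrib)
  qed
  also have "\<dots> = (\<integral>x. \<epsilon> * (indicator ?W x - collisions (Suc n) P x) \<partial>words)"
    using intW intc by (subst Bochner_Integration.integral_mult_right) (simp_all only: Bochner_Integration.integrable_diff Bochner_Integration.integral_diff W)
  also have "\<dots> \<le> (\<integral>x. norm (magnus_density (Suc n) x :: 'k) \<partial>words)"
  proof (rule integral_mono)
    show "integrable words (\<lambda>x. \<epsilon> * (indicator ?W x - collisions (Suc n) P x))"
      by (intro integrable_mult_right Bochner_Integration.integrable_diff intW intc)
    show "integrable words (\<lambda>x. norm (magnus_density (Suc n) x :: 'k))"
      by (intro integrable_norm integrable_magnus_density)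
    fix x assume "x \<in> space words"
    then have x: "x \<in> lists {0..<1}" by (simp only: space_words)
    show "\<epsilon> * (indicator ?W x - collisions (Suc n) P x) \<le> norm (magnus_density (Suc n) x :: 'k)"
    proof (cases "length x = Suc n \<and> distinct x")
      case True
      have "\<epsilon> * (indicator ?W x - collisions (Suc n) P x) \<le> \<epsilon> * 1"
        using \<epsilon> collisions_nonneg[of "Suc n" P x] by (intro mult_left_mono) (simp_all add: indicator_def)
      also have "\<dots> \<le> norm (magnus_density (Suc n) x :: 'k)"
        using norm_magnus_density_ge[OF x] True by (simp add: \<epsilon>_def)
      finally show ?thesis .
    next
      case False
      have "indicator ?W x \<le> collisions (Suc n) P x"
      proof (cases "length x = Suc n")
        case len: True
        with False obtain i j where ij: "i < Suc n" "j < Suc n" "i \<noteq> j" "x ! i = x ! j"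
          by (auto simp: distinct_conv_nth)
        \<comment> \<open>Equal letters trivially share a block, whatever the partition.\<close>
        have "x ! i \<in> \<Union>P" using x len ij(1) interval_partitionD(3)[OF P(1)] by (metis in_lists_conv_set nth_mem)
        then obtain J where "J \<in> P" "x ! i \<in> J" by blast
        then show ?thesis
          using collisions_ge_1[OF interval_partitionD(1)[OF P(1)] x len ij(1-3)] ij(4)
          by (simp add: indicator_def collisions_nonneg)
      qed (simp add: collisions_nonneg)
      then have "\<epsilon> * (indicator ?W x - collisions (Suc n) P x) \<le> 0"
        using \<epsilon> by (intro mult_nonneg_nonpos) simp_all
      then show ?thesis using norm_ge_zero order_trans by blast
    qed
  qed
  also have "\<dots> = ?N"
    by (intro norm_abs_F1[symmetric] integrable_magnus_density)
  finally show "1 / (real (Suc n) * 2 ^ n) \<le> ?N + e" by (simp only: \<epsilon>_def)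
qed

lemma not_summable_magnus_term:
  "\<not> summable (\<lambda>k. magnus_term (Suc k) {0..<1} (\<lambda>J. 2 *\<^sub>R Z1 J
      :: 'k::{real_normed_field,banach,second_countable_topology} F1))"
proof
  let ?u = "\<lambda>k x. 2 ^ Suc k *\<^sub>R (magnus_density (Suc k) x :: 'k)"
  have int: "integrable words (?u k)" for k
    by (intro integrable_scaleR_right integrable_magnus_density)
  have magnus: "magnus_term (Suc k) {0..<1} (\<lambda>J. 2 *\<^sub>R Z1 J :: 'k F1) = abs_F1 (?u k)" for k
    unfolding magnus_term_Z1 by (rule abs_F1_scaleR) (rule integrable_magnus_density)
  assume "summable (\<lambda>k. magnus_term (Suc k) {0..<1} (\<lambda>J. 2 *\<^sub>R Z1 J :: 'k F1))"
  then have "summable (\<lambda>k. norm (abs_F1 (?u k)))"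
    unfolding magnus
    \<comment> \<open>The term with index \<open>k\<close> has degree \<open>Suc k\<close>, because
      the expansion starts in degree 1.\<close>
    by (subst summable_homogeneous_iff[symmetric, where d = Suc])
      (auto simp: int magnus_density_eq_0 simp del: power_Suc intro: ccontr)
  moreover have "norm (inverse (real (Suc k))) \<le> norm (abs_F1 (?u k))" for k
  proof -
    \<comment> \<open>Half of the available bound 2 / (k + 1) is given away, so that the comparison
      series is the harmonic one.\<close>
    have "norm (inverse (real (Suc k))) = 2 ^ k * (1 / (real (Suc k) * 2 ^ k))"
      by (simp add: inverse_eq_divide del: of_nat_Suc)
    also have "\<dots> \<le> 2 ^ Suc k * norm (abs_F1 (magnus_density (Suc k)) :: 'k F1)"
      by (intro mult_mono norm_abs_F1_magnus_density_ge) simp_all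
    also have "\<dots> = norm (2 ^ Suc k *\<^sub>R (abs_F1 (magnus_density (Suc k)) :: 'k F1))"
      by simp
    also have "\<dots> = norm (abs_F1 (?u k))"
      by (simp only: abs_F1_scaleR[OF integrable_magnus_density])
    finally show ?thesis .
  qed
  ultimately have "summable (\<lambda>k. inverse (real (Suc k)))"
    by (rule summable_comparison_test'[where N = 0])
  then show False
    \<comment> \<open>The index shift only adds the term \<open>inverse 0 = 0\<close>.\<close>
    using not_summable_harmonic[where 'a = real] by (subst (asm) summable_Suc_iff) simp
qed

theorem theorem1p15:
  "(variation {0..<1} (\<lambda>J. 2 *\<^sub>R Z1 J :: real F1) = 2 \<and>
    \<not> summable (\<lambda>k. magnus_term (Suc k) {0..<1} (\<lambda>J. 2 *\<^sub>R Z1 J :: real F1))) \<and>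
   (variation {0..<1} (\<lambda>J. 2 *\<^sub>R Z1 J :: complex F1) = 2 \<and>
    \<not> summable (\<lambda>k. magnus_term (Suc k) {0..<1} (\<lambda>J. 2 *\<^sub>R Z1 J :: complex F1)))"
  by (intro conjI not_summable_magnus_term) (simp_all only: variation_scaleR_Z1 zero_le_numeral ennreal_numeral)

end
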